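(* Let $V$ be a finite set with $|V|=n$, and let $F\subseteq 2^V\setminus\{\emptyset,V\}$ be a well-provided crossing family, accessed via a membership oracle, such that every $U\in F$ contains an element $u$ and excludes an element $v$ with $V\setminus\{u\}\notin F$ and $\{v\}\notin F$. Then the Cosigning Forcing Algorithm, which outputs a cosigning of $F$, can be executed in time at most $2n^3T$, where $T$ is the best running time of an oracle polynomial algorithm for computing the minimum of a modular function over a well-provided lattice family on $V$. In particular, a cosigning of $F$ can be found in oracle polynomial time.
   Context: A family $F$ of subsets of $V$ is a crossing family if $U\cap W, U\cup W\in F$ for all $U,W\in F$ with $U\cap W\neq\emptyset$ and $U\cup W\neq V$. A cosigning of $F$ is a function $\sigma:V\to\{+,-\}$ such that every $U\in F$ contains a positive element and excludes a negative element. The set $V$ is given explicitly; the membership oracle, given any $U\subseteq V$, tells in unit time whether $U\in F$. A lattice family is a family closed under union and intersection; it is well-provided if it is given compactly by its unique inclusion-wise minimal and maximal sets together with a pre-order on the elements describing the family (its members are the sets between the minimal and the maximal set that are closed under the pre-order). The crossing family $F$ is well-provided if for all distinct $u,v\in V$ the lattice family $F_{uv}=\{U\in F: u\in U, v\notin U\}$ is well-provided. A modular function is $f(U)=\sum_{v\in U}a_v$ for some vector $a$ indexed by $V$. Cosigning Forcing Algorithm: start with all elements unsigned and sign elements one at a time. Given the current partial signing, an unsigned element $v$ is forced to be positive if there is $U\in F$ with $v\in U$ and all elements of $U\setminus\{v\}$ negatively signed (trivially forced if $\{v\}\in F$); it is forced to be negative if there is $W\in F$ with $v\notin W$ and all elements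 of $V\setminus(W\cup\{v\})$ positively signed (trivially forced if $V\setminus\{v\}\in F$). First sign all trivially forced elements accordingly. Then repeat until all elements are signed: if there is an unsigned forced element, sign it accordingly; otherwise pick an unsigned element and sign it arbitrarily. *)

theory Defs
  imports "HOL-Computational_Algebra.Polynomial"
begin

section \<open>Crossing families and cosignings\<close>

definition crossing_family :: "'a set \<Rightarrow> 'a set set \<Rightarrow> bool" where
  "crossing_family V F \<longleftrightarrow> F \<subseteq> Pow V \<and>
     (\<forall>U\<in>F. \<forall>W\<in>F. U \<inter> W \<noteq> {} \<and> U \<union> W \<noteq> V \<longrightarrow> U \<inter> W \<in> F \<and> U \<union> W \<in> F)"

datatype sign = Plus | Minus

definition cosigning :: "'a set \<Rightarrow> 'a set set \<Rightarrow> ('a \<Rightarrow> sign) \<Rightarrow> bool" where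
  "cosigning V F \<sigma> \<longleftrightarrow> (\<forall>U\<in>F. (\<exists>u\<in>U. \<sigma> u = Plus) \<and> (\<exists>v\<in>V - U. \<sigma> v = Minus))"

definition cosigning_hypotheses :: "'a set \<Rightarrow> 'a set set \<Rightarrow> bool" where
  "cosigning_hypotheses V F \<longleftrightarrow>
     finite V \<and> crossing_family V F \<and> F \<subseteq> Pow V - {{}, V} \<and>
     (\<forall>U\<in>F. \<exists>u\<in>U. \<exists>v\<in>V - U. V - {u} \<notin> F \<and> {v} \<notin> F)"


section \<open>Well-provided families\<close>

definition lattice_family :: "'a set \<Rightarrow> 'a set set \<Rightarrow> bool" where
  "lattice_family V L \<longleftrightarrow> L \<subseteq> Pow V \<and> (\<forall>U\<in>L. \<forall>W\<in>L. U \<inter> W \<in> L \<and> U \<union> W \<in> L)"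

record 'a description =
  least_set :: "'a set"
  greatest_set :: "'a set"
  preord :: "('a \<times> 'a) set"

text \<open>
  The empty lattice family has no minimal and maximal member; its description is
  \<open>None\<close>.
\<close>

fun describes :: "'a set \<Rightarrow> 'a description option \<Rightarrow> 'a set set \<Rightarrow> bool" where
  "describes V None L \<longleftrightarrow> L = {}"
| "describes V (Some D) L \<longleftrightarrow>
     least_set D \<in> L \<and> greatest_set D \<in> L \<and> preorder_on V (preord D) \<and>
     L = {X. least_set D \<subseteq> X \<and> X \<subseteq> greatest_set D \<and>
             (\<forall>(x, y)\<in>preord D. x \<in> X \<longrightarrow> y \<in> X)}"

definition separating_subfamily :: "'a set set \<Rightarrow> 'a \<Rightarrow> 'a \<Rightarrow> 'a set set" where
  "separating_subfamily F u v = {U \<in> F. u \<in> U \<and> v \<notin> U}"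

definition well_provided ::
  "'a set \<Rightarrow> 'a set set \<Rightarrow> ('a \<Rightarrow> 'a \<Rightarrow> 'a description option) \<Rightarrow> bool" where
  "well_provided V F d \<longleftrightarrow>
     (\<forall>u\<in>V. \<forall>v\<in>V. u \<noteq> v \<longrightarrow> describes V (d u v) (separating_subfamily F u v))"


section \<open>The Cosigning Forcing Algorithm\<close>

definition trivially_forced :: "'a set \<Rightarrow> 'a set set \<Rightarrow> 'a \<Rightarrow> sign \<Rightarrow> bool" where
  "trivially_forced V F v s \<longleftrightarrow> (case s of Plus \<Rightarrow> {v} \<in> F | Minus \<Rightarrow> V - {v} \<in> F)"

definition forced :: "'a set \<Rightarrow> 'a set set \<Rightarrow> ('a \<rightharpoonup> sign) \<Rightarrow> 'a \<Rightarrow> sign \<Rightarrow> bool" where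
  "forced V F \<sigma> v s \<longleftrightarrow> (case s of
       Plus \<Rightarrow> \<exists>U\<in>F. v \<in> U \<and> (\<forall>w\<in>U - {v}. \<sigma> w = Some Minus)
     | Minus \<Rightarrow> \<exists>W\<in>F. v \<notin> W \<and> (\<forall>w\<in>V - (W \<union> {v}). \<sigma> w = Some Plus))"

text \<open>
  Giving sign \<open>s\<close> to \<open>v\<close> is a legal next step at the partial signing \<open>\<sigma>\<close>. Whether an
  element is trivially forced does not depend on \<open>\<sigma>\<close>, so the initial phase is a matter
  of priority.
\<close>

definition cfa_step :: "'a set \<Rightarrow> 'a set set \<Rightarrow> ('a \<rightharpoonup> sign) \<Rightarrow> 'a \<Rightarrow> sign \<Rightarrow> bool" where
  "cfa_step V F \<sigma> v s \<longleftrightarrow> v \<in> V \<and> \<sigma> v = None \<and>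
     (if \<exists>w\<in>V. \<sigma> w = None \<and> (\<exists>r. trivially_forced V F w r) then trivially_forced V F v s
      else if \<exists>w\<in>V. \<sigma> w = None \<and> (\<exists>r. forced V F \<sigma> w r) then forced V F \<sigma> v s
      else True)"

text \<open>A run is the list of the signed elements, in the order of their signing.\<close>

fun cfa_run_from :: "'a set \<Rightarrow> 'a set set \<Rightarrow> ('a \<rightharpoonup> sign) \<Rightarrow> ('a \<times> sign) list \<Rightarrow> bool" where
  "cfa_run_from V F \<sigma> [] \<longleftrightarrow> (\<forall>v\<in>V. \<sigma> v \<noteq> None)"
| "cfa_run_from V F \<sigma> ((v, s) # xs) \<longleftrightarrow> cfa_step V F \<sigma> v s \<and> cfa_run_from V F (\<sigma>(v \<mapsto> s)) xs"

abbreviation cfa_run :: "'a set \<Rightarrow> 'a set set \<Rightarrow> ('a \<times> sign) list \<Rightarrow> bool" where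
  "cfa_run V F \<equiv> cfa_run_from V F Map.empty"

definition signing_of :: "('a \<times> sign) list \<Rightarrow> 'a \<Rightarrow> sign" where
  "signing_of xs v = the (map_of xs v)"


section \<open>Oracle programs and their running time\<close>

text \<open>
  A random access machine on integers, given as a while language: integer registers,
  integer arrays of unbounded size, read-only input tables, a membership oracle, and an
  append-only output. Every instruction and every test takes one unit of time. There is
  no multiplication, so numbers grow by at most a constant number of bits per step and
  unit cost is polynomially equivalent to bit cost.
\<close>

datatype operand = Reg nat | Const int

datatype test = Less operand operand | Equal operand operand

datatype table = Size | Weight | Nonempty | Least | Greatest | Preorder

datatype instr =
    Copy nat operand
  | Add nat operand operand
  | Sub nat operand operand
  | Load nat nat operand
  | Store nat operand operand
  | Read nat table "operand list"
  | Query nat nat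
  | Emit operand

datatype program =
    Do instr
  | Seq program program
  | Cond test program program
  | While test program

type_synonym input = "table \<Rightarrow> int list \<Rightarrow> int"

type_synonym set_oracle = "nat set \<Rightarrow> bool"

record state =
  regs :: "nat \<Rightarrow> int"
  arrays :: "nat \<Rightarrow> int \<Rightarrow> int"
  out :: "int list"

definition initial :: state where
  "initial = \<lparr>regs = (\<lambda>_. 0), arrays = (\<lambda>_ _. 0), out = []\<rparr>"

fun operand_val :: "state \<Rightarrow> operand \<Rightarrow> int" where
  "operand_val s (Reg x) = regs s x"
| "operand_val s (Const c) = c"

fun test_val :: "state \<Rightarrow> test \<Rightarrow> bool" where
  "test_val s (Less a b) \<longleftrightarrow> operand_val s a < operand_val s b"
| "test_val s (Equal a b) \<longleftrightarrow> operand_val s a = operand_val s b"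

definition set_reg :: "nat \<Rightarrow> int \<Rightarrow> state \<Rightarrow> state" where
  "set_reg x c s = s\<lparr>regs := (regs s)(x := c)\<rparr>"

text \<open>
  \<open>Query x A\<close> asks the oracle about the set whose characteristic vector is the array \<open>A\<close>.
\<close>

fun perform :: "input \<Rightarrow> set_oracle \<Rightarrow> instr \<Rightarrow> state \<Rightarrow> state" where
  "perform inp orc (Copy x a) s = set_reg x (operand_val s a) s"
| "perform inp orc (Add x a b) s = set_reg x (operand_val s a + operand_val s b) s"
| "perform inp orc (Sub x a b) s = set_reg x (operand_val s a - operand_val s b) s"
| "perform inp orc (Load x A i) s = set_reg x (arrays s A (operand_val s i)) s"
| "perform inp orc (Store A i a) s =
     s\<lparr>arrays := (arrays s)(A := (arrays s A)(operand_val s i := operand_val s a))\<rparr>"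
| "perform inp orc (Read x tb is) s = set_reg x (inp tb (map (operand_val s) is)) s"
| "perform inp orc (Query x A) s = set_reg x (of_bool (orc {i. arrays s A (int i) \<noteq> 0})) s"
| "perform inp orc (Emit a) s = s\<lparr>out := out s @ [operand_val s a]\<rparr>"

text \<open>
  \<open>exec inp orc c s t s'\<close>: started in state \<open>s\<close>, the program \<open>c\<close> terminates in state \<open>s'\<close>
  after exactly \<open>t\<close> units of time.
\<close>

inductive exec :: "input \<Rightarrow> set_oracle \<Rightarrow> program \<Rightarrow> state \<Rightarrow> nat \<Rightarrow> state \<Rightarrow> bool"
  for inp :: input and orc :: set_oracle where
  exec_Do: "exec inp orc (Do i) s 1 (perform inp orc i s)"
| exec_Seq: "exec inp orc c s t s' \<Longrightarrow> exec inp orc c' s' t' s''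
    \<Longrightarrow> exec inp orc (Seq c c') s (t + t') s''"
| exec_CondT: "test_val s b \<Longrightarrow> exec inp orc c s t s' \<Longrightarrow> exec inp orc (Cond b c c') s (1 + t) s'"
| exec_CondF: "\<not> test_val s b \<Longrightarrow> exec inp orc c' s t s' \<Longrightarrow> exec inp orc (Cond b c c') s (1 + t) s'"
| exec_WhileF: "\<not> test_val s b \<Longrightarrow> exec inp orc (While b c) s 1 s"
| exec_WhileT: "test_val s b \<Longrightarrow> exec inp orc c s t s' \<Longrightarrow> exec inp orc (While b c) s' t' s''
    \<Longrightarrow> exec inp orc (While b c) s (1 + t + t') s''"

definition computes_in ::
  "program \<Rightarrow> input \<Rightarrow> set_oracle \<Rightarrow> nat \<Rightarrow> int list \<Rightarrow> bool" where
  "computes_in P inp orc t ys \<longleftrightarrow> (\<exists>s. exec inp orc P initial t s \<and> out s = ys)"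


section \<open>Minimising a modular function over a well-provided lattice family\<close>

fun lattice_input :: "nat \<Rightarrow> nat description \<Rightarrow> (nat \<Rightarrow> int) \<Rightarrow> input" where
  "lattice_input n D a Size [] = int n"
| "lattice_input n D a Weight [i] = a (nat i)"
| "lattice_input n D a Least [i] = of_bool (nat i \<in> least_set D)"
| "lattice_input n D a Greatest [i] = of_bool (nat i \<in> greatest_set D)"
| "lattice_input n D a Preorder [i, j] = of_bool ((nat i, nat j) \<in> preord D)"
| "lattice_input n D a _ _ = 0"

definition lattice_oracle :: "nat \<Rightarrow> nat set set \<Rightarrow> set_oracle" where
  "lattice_oracle n L X \<longleftrightarrow> X \<inter> {..<n} \<in> L"

definition modular :: "('a \<Rightarrow> int) \<Rightarrow> 'a set \<Rightarrow> int" where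
  "modular a U = (\<Sum>v\<in>U. a v)"

definition minimises_within :: "program \<Rightarrow> nat \<Rightarrow> nat \<Rightarrow> bool" where
  "minimises_within M n T \<longleftrightarrow>
     (\<forall>L D a. lattice_family {..<n} L \<and> describes {..<n} (Some D) L \<longrightarrow>
        (\<exists>t\<le>T. computes_in M (lattice_input n D a) (lattice_oracle n L) t
                 [Min (modular a ` L)]))"

definition oracle_polynomial_minimiser :: "program \<Rightarrow> bool" where
  "oracle_polynomial_minimiser M \<longleftrightarrow> (\<exists>p :: nat poly. \<forall>n. minimises_within M n (poly p n))"

text \<open>
  \<open>T\<close> is a worst-case time, on ground sets of size \<open>n\<close>, of some oracle polynomial minimiser;
  the best running time is the least such \<open>T\<close>.
\<close>

definition minimiser_time :: "nat \<Rightarrow> nat \<Rightarrow> bool" where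
  "minimiser_time n T \<longleftrightarrow> (\<exists>M. oracle_polynomial_minimiser M \<and> minimises_within M n T)"


section \<open>Crossing families as inputs of programs\<close>

text \<open>
  A program refers to the elements of \<open>V\<close> by their numbers in an enumeration \<open>e\<close> of \<open>V\<close>.
\<close>

definition enumerates :: "(nat \<Rightarrow> 'a) \<Rightarrow> 'a set \<Rightarrow> bool" where
  "enumerates e V \<longleftrightarrow> bij_betw e {..<card V} V"

fun crossing_input ::
  "nat \<Rightarrow> (nat \<Rightarrow> 'a) \<Rightarrow> ('a \<Rightarrow> 'a \<Rightarrow> 'a description option) \<Rightarrow> input" where
  "crossing_input n e d Size [] = int n"
| "crossing_input n e d Nonempty [i, j] = of_bool (d (e (nat i)) (e (nat j)) \<noteq> None)"
| "crossing_input n e d Least [i, j, k] =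
     (case d (e (nat i)) (e (nat j)) of None \<Rightarrow> 0
      | Some D \<Rightarrow> of_bool (e (nat k) \<in> least_set D))"
| "crossing_input n e d Greatest [i, j, k] =
     (case d (e (nat i)) (e (nat j)) of None \<Rightarrow> 0
      | Some D \<Rightarrow> of_bool (e (nat k) \<in> greatest_set D))"
| "crossing_input n e d Preorder [i, j, k, l] =
     (case d (e (nat i)) (e (nat j)) of None \<Rightarrow> 0
      | Some D \<Rightarrow> of_bool ((e (nat k), e (nat l)) \<in> preord D))"
| "crossing_input n e d _ _ = 0"

definition crossing_oracle :: "nat \<Rightarrow> (nat \<Rightarrow> 'a) \<Rightarrow> 'a set set \<Rightarrow> set_oracle" where
  "crossing_oracle n e F X \<longleftrightarrow> e ` (X \<inter> {..<n}) \<in> F"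

text \<open>
  Output format: \<open>i + 1\<close> says that element number \<open>i\<close> is signed positively, \<open>- (i + 1)\<close>
  that it is signed negatively.
\<close>

fun literal :: "nat \<times> sign \<Rightarrow> int" where
  "literal (i, Plus) = int i + 1"
| "literal (i, Minus) = - (int i + 1)"

end

theory Submission
  imports Defs
begin

text \<open>
  A run never leaves the \<^emph>\<open>consistent\<close> partial signings: no member of \<open>F\<close> is entirely negative
  and no complement of a member is entirely positive. While only trivially forced elements are
  signed, this is the hypothesis on \<open>F\<close>. Afterwards, a step could fail only at an element \<open>v\<close> that is
  forced both ways, by \<open>U\<close> containing \<open>v\<close> and \<open>W\<close> omitting \<open>v\<close>. Then \<open>U \<inter> W\<close> would be negative, so by
  consistency it is not a member, and as \<open>F\<close> is crossing, \<open>U\<close> and \<open>W\<close> are disjoint or cover \<open>V\<close>; since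
  no element has two signs, \<open>U = {v}\<close> or \<open>W = V - {v}\<close>, and \<open>v\<close> was trivially forced
  (\<open>forced_both_ways\<close>, \<open>cfa_run_cosigning\<close>).

  For the running time it suffices to look at single entries of the given tables. Whether \<open>v\<close> is
  forced to be positive can be seen in the least member of \<open>F\<^sub>v\<^sub>w\<close> for \<^emph>\<open>any one\<close> element \<open>w \<noteq> v\<close> that is
  not negative: a set forcing \<open>v\<close> omits every such \<open>w\<close>, so it lies in \<open>F\<^sub>v\<^sub>w\<close>, and the least member
  forces \<open>v\<close> as well. Dually, the greatest member of \<open>F\<^sub>q\<^sub>v\<close> decides whether \<open>v\<close> is forced to be
  negative, for any one \<open>q \<noteq> v\<close> that is not positive (\<open>forced_Plus_iff_least\<close>,
  \<open>forced_Minus_iff_greatest\<close>). Hence one step needs two table rows for each unsigned element, and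
  a whole run needs cubic time.

  The program keeps the unsigned elements in an array. In each round the last of them, \<open>z\<close>, serves
  as \<open>w\<close>, and \<open>q\<close> is a negative element, or \<open>z\<close> while nothing is negative. If no other element is
  forced, \<open>z\<close> itself is signed, and no second witness is needed for it: if \<open>q \<noteq> z\<close>, it becomes
  negative if that is forced and positive otherwise, which is right whether it is forced or free;
  if \<open>q = z\<close>, nothing is negative, so \<open>z\<close> could be forced to be positive only trivially and
  may become negative (\<open>search_verdict\<close>).

  The bound \<open>2n\<^sup>3T\<close> needs a lower bound on \<open>T\<close>. On the lattice family \<open>{V}\<close> with all weights 1, a
  minimiser must read each of the \<open>n\<close> weights. It must also exclude each family \<open>{V - {j}, V}\<close>,
  whose description differs in one entry only; for that it reads this entry or asks the oracle about
  \<open>V - {j}\<close>. Together with the output, \<open>T \<ge> 2n + 1\<close> (\<open>minimiser_time_lower_bound\<close>). The program takes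
  time at most \<open>(12n + 5)n(n + 1)/2 + 32n + 6\<close>, which is below \<open>2n\<^sup>3(2n + 1)\<close> for \<open>n \<ge> 3\<close>; the
  sizes up to 2 are treated apart. The same bound is polynomial in \<open>n\<close>, which is the last claim.
\<close>

section \<open>Every run of the algorithm yields a cosigning\<close>

text \<open>
  Runs are defined by recursion on the remaining steps, whereas invariants and the program need the
  signed part to grow at its end.
\<close>
inductive legal_prefix :: "'a set \<Rightarrow> 'a set set \<Rightarrow> ('a \<times> sign) list \<Rightarrow> bool" for V F where
  legal_prefix_Nil: "legal_prefix V F []"
| legal_prefix_snoc: "legal_prefix V F xs \<Longrightarrow> cfa_step V F (map_of xs) v s \<Longrightarrow> legal_prefix V F (xs @ [(v, s)])"

lemma map_of_snoc: "map_of xs v = None \<Longrightarrow> map_of (xs @ [(v, s)]) = (map_of xs)(v \<mapsto> s)"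
  by (auto simp: map_add_def fun_eq_iff split: option.splits)

lemma cfa_step_new: "cfa_step V F \<sigma> v s \<Longrightarrow> v \<in> V \<and> \<sigma> v = None"
  by (simp add: cfa_step_def)

lemma legal_append_cfa_run:
  assumes "legal_prefix V F xs" "cfa_run_from V F (map_of xs) ys"
  shows "cfa_run V F (xs @ ys)"
  using assms
proof (induction arbitrary: ys rule: legal_prefix.induct)
  case (legal_prefix_snoc xs v s)
  have "map_of (xs @ [(v, s)]) = (map_of xs)(v \<mapsto> s)"
    using legal_prefix_snoc.hyps(2) by (intro map_of_snoc) (simp add: cfa_step_def)
  then have "cfa_run_from V F (map_of xs) ((v, s) # ys)"
    using legal_prefix_snoc.hyps(2) legal_prefix_snoc.prems by (simp del: fun_upd_apply map_of_append)
  from legal_prefix_snoc.IH[OF this] show ?case by simp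
qed simp

lemma legal_append:
  assumes "legal_prefix V F xs" "cfa_run_from V F (map_of xs) ys"
  shows "legal_prefix V F (xs @ ys) \<and> (\<forall>v\<in>V. map_of (xs @ ys) v \<noteq> None)"
  using assms
proof (induction ys arbitrary: xs)
  case (Cons a ys)
  obtain v s where a: "a = (v, s)" by force
  have step: "cfa_step V F (map_of xs) v s" using Cons.prems(2) a by simp
  have "map_of (xs @ [(v, s)]) = (map_of xs)(v \<mapsto> s)"
    using step by (intro map_of_snoc) (simp add: cfa_step_def)
  then have "cfa_run_from V F (map_of (xs @ [(v, s)])) ys"
    using Cons.prems(2) a by simp
  from Cons.IH[OF legal_prefix.legal_prefix_snoc[OF Cons.prems(1) step] this] a
  show ?case by simp
qed simp

lemma cfa_run_iff_legal:
  "cfa_run V F xs \<longleftrightarrow> legal_prefix V F xs \<and> (\<forall>v\<in>V. map_of xs v \<noteq> None)"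
proof
  assume "cfa_run V F xs"
  then show "legal_prefix V F xs \<and> (\<forall>v\<in>V. map_of xs v \<noteq> None)"
    using legal_append[OF legal_prefix_Nil, of V F xs] by (simp add: empty_def)
next
  assume "legal_prefix V F xs \<and> (\<forall>v\<in>V. map_of xs v \<noteq> None)"
  then show "cfa_run V F xs"
    using legal_append_cfa_run[of V F xs "[]"] by simp
qed

lemma legal_distinct:
  assumes "legal_prefix V F xs"
  shows "distinct (map fst xs)"
  using assms
proof induction
  case (legal_prefix_snoc xs v s)
  then show ?case using cfa_step_new[OF legal_prefix_snoc.hyps(2)] by (auto simp: map_of_eq_None_iff)
qed simp

text \<open>
  For a total signing this is the cosigning property.
\<close>
definition consistent :: "'a set \<Rightarrow> 'a set set \<Rightarrow> ('a \<rightharpoonup> sign) \<Rightarrow> bool" where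
  "consistent V F \<sigma> \<longleftrightarrow> (\<forall>U\<in>F. (\<exists>w\<in>U. \<sigma> w \<noteq> Some Minus) \<and> (\<exists>w\<in>V - U. \<sigma> w \<noteq> Some Plus))"

text \<open>
  This is where the crossing property enters: \<open>U \<inter> W\<close> omits \<open>v\<close>, so all its elements are negative and
  it cannot be a member.
\<close>
lemma forced_both_ways:
  assumes crossing: "crossing_family V F"
    and cons: "consistent V F \<sigma>"
    and "v \<in> V" "forced V F \<sigma> v Plus" "forced V F \<sigma> v Minus"
  shows "trivially_forced V F v Plus \<or> trivially_forced V F v Minus"
proof -
  obtain U where U: "U \<in> F" "v \<in> U" "\<forall>w\<in>U - {v}. \<sigma> w = Some Minus"
    using assms(4) by (auto simp: forced_def)
  obtain W where W: "W \<in> F" "v \<notin> W" "\<forall>w\<in>V - (W \<union> {v}). \<sigma> w = Some Plus"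
    using assms(5) by (auto simp: forced_def)
  have sub: "U \<subseteq> V" "W \<subseteq> V" using crossing U(1) W(1) by (auto simp: crossing_family_def)
  have notF: "U \<inter> W \<notin> F"
  proof
    assume "U \<inter> W \<in> F"
    then obtain w where "w \<in> U \<inter> W" "\<sigma> w \<noteq> Some Minus" using cons unfolding consistent_def by blast
    then show False using U(3) W(2) by auto
  qed
  have "U \<inter> W = {} \<or> U \<union> W = V"
    using crossing U(1) W(1) notF unfolding crossing_family_def by blast
  then show ?thesis
  proof
    assume disj: "U \<inter> W = {}"
    have "U \<subseteq> {v}"
    proof
      fix w assume w: "w \<in> U"
      show "w \<in> {v}"
      proof (rule ccontr)
        assume "w \<notin> {v}"
        then have "\<sigma> w = Some Minus" "\<sigma> w = Some Plus" using w U(3) W(3) disj sub by blast+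
        then show False by simp
      qed
    qed
    then have "U = {v}" using U(2) by auto
    then show ?thesis using U(1) by (simp add: trivially_forced_def)
  next
    assume un: "U \<union> W = V"
    have "V - {v} \<subseteq> W"
    proof
      fix w assume w: "w \<in> V - {v}"
      show "w \<in> W"
      proof (rule ccontr)
        assume "w \<notin> W"
        then have "\<sigma> w = Some Minus" "\<sigma> w = Some Plus" using w U(3) W(3) un by blast+
        then show False by simp
      qed
    qed
    then have "W = V - {v}" using W(2) sub by auto
    then show ?thesis using W(1) by (simp add: trivially_forced_def)
  qed
qed

text \<open>
  The hypothesis on \<open>F\<close> supplies, for each member, an element that is not trivially forced to be
  negative and an outside element that is not trivially forced to be positive.
\<close>
lemma trivial_signing_consistent:
  assumes hyp: "cosigning_hypotheses V F"
    and triv: "\<And>v s. \<sigma> v = Some s \<Longrightarrow> trivially_forced V F v s"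
  shows "consistent V F \<sigma>"
  unfolding consistent_def
proof (intro ballI conjI)
  fix U assume "U \<in> F"
  then obtain u v where uv: "u \<in> U" "v \<in> V - U" "V - {u} \<notin> F" "{v} \<notin> F"
    using hyp unfolding cosigning_hypotheses_def by blast
  have "\<sigma> u \<noteq> Some Minus" using triv[of u Minus] uv(3) by (auto simp: trivially_forced_def)
  then show "\<exists>w\<in>U. \<sigma> w \<noteq> Some Minus" using uv(1) by blast
  have "\<sigma> v \<noteq> Some Plus" using triv[of v Plus] uv(4) by (auto simp: trivially_forced_def)
  then show "\<exists>w\<in>V - U. \<sigma> w \<noteq> Some Plus" using uv(2) by blast
qed

text \<open>
  A member that becomes negative by signing \<open>v\<close> would have forced \<open>v\<close> to be positive, and dually.
\<close>
lemma consistent_step: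
  assumes cons: "consistent V F \<sigma>" and "\<sigma> v = None"
    and "\<not> forced V F \<sigma> v (case s of Plus \<Rightarrow> Minus | Minus \<Rightarrow> Plus)"
  shows "consistent V F (\<sigma>(v \<mapsto> s))"
  using assms unfolding consistent_def forced_def
  by (cases s) (fastforce split: if_splits)+

text \<open>
  The second conjunct says that the trivial phase signs nothing else; it carries consistency to the
  end of that phase, from where \<open>forced_both_ways\<close> takes over.
\<close>
lemma legal_consistent:
  assumes hyp: "cosigning_hypotheses V F" and "legal_prefix V F xs"
  shows "consistent V F (map_of xs) \<and>
    ((\<exists>w\<in>V. map_of xs w = None \<and> (\<exists>r. trivially_forced V F w r)) \<longrightarrow>
       (\<forall>v s. map_of xs v = Some s \<longrightarrow> trivially_forced V F v s))"
  using assms(2)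
proof induction
  case legal_prefix_Nil
  show ?case using trivial_signing_consistent[OF hyp, of "map_of []"] by simp
next
  case (legal_prefix_snoc xs v s)
  let ?\<sigma> = "map_of xs"
  note step = legal_prefix_snoc.hyps(2)
  have v: "v \<in> V" "?\<sigma> v = None" using cfa_step_new[OF step] by auto
  have upd: "map_of (xs @ [(v, s)]) = ?\<sigma>(v \<mapsto> s)" by (rule map_of_snoc[OF v(2)])
  have crossing: "crossing_family V F" using hyp by (simp add: cosigning_hypotheses_def)
  show ?case
  proof (cases "\<exists>w\<in>V. ?\<sigma> w = None \<and> (\<exists>r. trivially_forced V F w r)")
    case True
    then have "trivially_forced V F v s" using step by (auto simp: cfa_step_def)
    then have "\<And>w r. (?\<sigma>(v \<mapsto> s)) w = Some r \<Longrightarrow> trivially_forced V F w r"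
      using legal_prefix_snoc.IH True by (auto split: if_splits)
    then show ?thesis using trivial_signing_consistent[OF hyp] upd by metis
  next
    case no_triv: False
    let ?r = "case s of Plus \<Rightarrow> Minus | Minus \<Rightarrow> Plus"
    have "\<not> forced V F ?\<sigma> v ?r"
    proof
      assume opp: "forced V F ?\<sigma> v ?r"
      then have "forced V F ?\<sigma> v s" using step no_triv v unfolding cfa_step_def by metis
      then have "forced V F ?\<sigma> v Plus" "forced V F ?\<sigma> v Minus" using opp by (cases s; simp)+
      then show False
        using forced_both_ways[OF crossing _ v(1)] legal_prefix_snoc.IH no_triv v by blast
    qed
    then have "consistent V F (?\<sigma>(v \<mapsto> s))"
      using consistent_step[of V F ?\<sigma>] legal_prefix_snoc.IH v(2) by blast
    moreover have "\<not> (\<exists>w\<in>V. (?\<sigma>(v \<mapsto> s)) w = None \<and> (\<exists>r. trivially_forced V F w r))"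
      using no_triv by auto
    ultimately show ?thesis unfolding upd by blast
  qed
qed

lemma cfa_run_cosigning:
  assumes "cosigning_hypotheses V F" "cfa_run V F xs"
  shows "cosigning V F (signing_of xs)"
proof -
  have cons: "consistent V F (map_of xs)" and total: "\<forall>v\<in>V. map_of xs v \<noteq> None"
    using legal_consistent assms cfa_run_iff_legal by blast+
  have sub: "U \<subseteq> V" if "U \<in> F" for U using assms(1) that by (auto simp: cosigning_hypotheses_def)
  have *: "signing_of xs v = s" if "v \<in> V" "map_of xs v \<noteq> Some (case s of Plus \<Rightarrow> Minus | Minus \<Rightarrow> Plus)" for v s
    using that total by (cases "signing_of xs v"; cases s) (auto simp: signing_of_def)
  show ?thesis unfolding cosigning_def
  proof (intro ballI conjI)
    fix U assume U: "U \<in> F"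
    obtain u v where "u \<in> U" "map_of xs u \<noteq> Some Minus" "v \<in> V - U" "map_of xs v \<noteq> Some Plus"
      using cons U unfolding consistent_def by blast
    then show "\<exists>u\<in>U. signing_of xs u = Plus" "\<exists>v\<in>V - U. signing_of xs v = Minus"
      using *[of u Plus] *[of v Minus] sub[OF U] by auto
  qed
qed

section \<open>A lower bound for the time of a minimiser\<close>

lemma exec_deterministic:
  "exec inp orc c s t s' \<Longrightarrow> exec inp orc c s u s'' \<Longrightarrow> u = t \<and> s'' = s'"
proof (induction arbitrary: u s'' rule: exec.induct)
  case (exec_Do i s)
  then show ?case by (auto elim: exec.cases)
next
  case (exec_Seq c s t s' c' t' s2)
  from exec_Seq.prems show ?case by cases (use exec_Seq.IH in blast)
next
  case (exec_CondT s b c t s' c')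
  from exec_CondT.prems show ?case by cases (use exec_CondT.IH exec_CondT.hyps(1) in blast)+
next
  case (exec_CondF s b c' t s' c)
  from exec_CondF.prems show ?case by cases (use exec_CondF.IH exec_CondF.hyps(1) in blast)+
next
  case (exec_WhileF s b c)
  from exec_WhileF.prems show ?case by cases (use exec_WhileF.hyps in simp_all)
next
  case (exec_WhileT s b c t s' t' s2)
  from exec_WhileT.prems show ?case by cases (use exec_WhileT in blast)+
qed

text \<open>
  \<open>A\<close> and \<open>B\<close> are the table entries and oracle queries that a computation looked at.
\<close>
definition agree :: "(table \<times> int list) set \<Rightarrow> nat set set \<Rightarrow> input \<Rightarrow> set_oracle \<Rightarrow> input \<Rightarrow> set_oracle \<Rightarrow> bool" where
  "agree A B inp orc inp' orc' \<longleftrightarrow>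
     (\<forall>(tb, is)\<in>A. inp' tb is = inp tb is) \<and> (\<forall>X\<in>B. orc' X = orc X)"

lemma agree_Un: "agree (A \<union> A') (B \<union> B') inp orc inp' orc' \<longleftrightarrow>
    agree A B inp orc inp' orc' \<and> agree A' B' inp orc inp' orc'"
  by (auto simp: agree_def)

text \<open>
  Each unit of time reveals at most one table entry or oracle answer or emits one number, and a
  computation is unchanged on every input that agrees on what was revealed.
\<close>
lemma exec_probes:
  "exec inp orc c s t s' \<Longrightarrow> \<exists>A B. finite A \<and> finite B \<and>
     length (out s') + card A + card B \<le> length (out s) + t \<and>
     (\<forall>inp' orc'. agree A B inp orc inp' orc' \<longrightarrow> exec inp' orc' c s t s')"
proof (induction rule: exec.induct)
  case (exec_Do i s)
  let ?A = "case i of Read x tb is \<Rightarrow> {(tb, map (operand_val s) is)} | _ \<Rightarrow> {}"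
  let ?B = "case i of Query x A \<Rightarrow> {{i. arrays s A (int i) \<noteq> 0}} | _ \<Rightarrow> {}"
  have "finite ?A" "finite ?B" by (cases i; simp)+
  moreover have "length (out (perform inp orc i s)) + card ?A + card ?B \<le> length (out s) + 1"
    by (cases i) (auto simp: set_reg_def)
  moreover have "exec inp' orc' (Do i) s 1 (perform inp orc i s)"
    if "agree ?A ?B inp orc inp' orc'" for inp' orc'
  proof -
    have "perform inp orc i s = perform inp' orc' i s"
      using that by (cases i) (auto simp: agree_def)
    then show ?thesis using exec.exec_Do[of inp' orc' i s] by simp
  qed
  ultimately show ?case by blast
next
  case (exec_Seq c s t s' c' t' s2)
  obtain A B A' B' where *: "finite A" "finite B" "finite A'" "finite B'"
    "length (out s') + card A + card B \<le> length (out s) + t"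
    "length (out s2) + card A' + card B' \<le> length (out s') + t'"
    "\<forall>inp' orc'. agree A B inp orc inp' orc' \<longrightarrow> exec inp' orc' c s t s'"
    "\<forall>inp' orc'. agree A' B' inp orc inp' orc' \<longrightarrow> exec inp' orc' c' s' t' s2"
    using exec_Seq.IH by blast
  have "card (A \<union> A') \<le> card A + card A'" "card (B \<union> B') \<le> card B + card B'"
    by (rule card_Un_le)+
  then have "length (out s2) + card (A \<union> A') + card (B \<union> B') \<le> length (out s) + (t + t')"
    using *(5,6) by linarith
  moreover have "exec inp' orc' (Seq c c') s (t + t') s2"
    if "agree (A \<union> A') (B \<union> B') inp orc inp' orc'" for inp' orc'
    using that *(7,8) unfolding agree_Un by (blast intro: exec.exec_Seq)
  ultimately show ?case using *(1-4) by (meson finite_UnI)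
next
  case (exec_WhileT s b c t s' t' s2)
  obtain A B A' B' where *: "finite A" "finite B" "finite A'" "finite B'"
    "length (out s') + card A + card B \<le> length (out s) + t"
    "length (out s2) + card A' + card B' \<le> length (out s') + t'"
    "\<forall>inp' orc'. agree A B inp orc inp' orc' \<longrightarrow> exec inp' orc' c s t s'"
    "\<forall>inp' orc'. agree A' B' inp orc inp' orc' \<longrightarrow> exec inp' orc' (While b c) s' t' s2"
    using exec_WhileT.IH by blast
  have "card (A \<union> A') \<le> card A + card A'" "card (B \<union> B') \<le> card B + card B'"
    by (rule card_Un_le)+
  then have "length (out s2) + card (A \<union> A') + card (B \<union> B') \<le> length (out s) + (1 + t + t')"
    using *(5,6) by linarith
  moreover have "exec inp' orc' (While b c) s (1 + t + t') s2"
    if "agree (A \<union> A') (B \<union> B') inp orc inp' orc'" for inp' orc'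
    using that *(7,8) exec_WhileT.hyps(1) unfolding agree_Un by (blast intro: exec.exec_WhileT)
  ultimately show ?case using *(1-4) by (meson finite_UnI)
next
  case (exec_CondT s b c t s' c')
  obtain A B where *: "finite A" "finite B"
    "length (out s') + card A + card B \<le> length (out s) + t"
    "\<forall>inp' orc'. agree A B inp orc inp' orc' \<longrightarrow> exec inp' orc' c s t s'"
    using exec_CondT.IH by blast
  have "exec inp' orc' (Cond b c c') s (1 + t) s'" if "agree A B inp orc inp' orc'" for inp' orc'
    using that *(4) exec_CondT.hyps(1) by (blast intro: exec.exec_CondT)
  moreover have "length (out s') + card A + card B \<le> length (out s) + (1 + t)" using *(3) by simp
  ultimately show ?case using *(1,2) by blast
next
  case (exec_CondF s b c' t s' c)
  obtain A B where *: "finite A" "finite B"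
    "length (out s') + card A + card B \<le> length (out s) + t"
    "\<forall>inp' orc'. agree A B inp orc inp' orc' \<longrightarrow> exec inp' orc' c' s t s'"
    using exec_CondF.IH by blast
  have "exec inp' orc' (Cond b c c') s (1 + t) s'" if "agree A B inp orc inp' orc'" for inp' orc'
    using that *(4) exec_CondF.hyps(1) by (blast intro: exec.exec_CondF)
  moreover have "length (out s') + card A + card B \<le> length (out s) + (1 + t)" using *(3) by simp
  ultimately show ?case using *(1,2) by blast
next
  case (exec_WhileF s b c)
  have "exec inp' orc' (While b c) s 1 s" for inp' orc' by (rule exec.exec_WhileF[OF exec_WhileF])
  then show ?case by (intro exI[of _ "{}"]) simp
qed

text \<open>
  The preorder is the identity, so that the families \<open>{V}\<close> and \<open>{V - {j}, V}\<close> have descriptions that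
  differ only in the least set.
\<close>
lemma describes_interval:
  assumes "X \<subseteq> V"
  shows "describes V (Some \<lparr>least_set = X, greatest_set = V, preord = Id_on V\<rparr>) {Y. X \<subseteq> Y \<and> Y \<subseteq> V}"
  using assms by (auto simp: preorder_on_def refl_on_def trans_def)

lemma lattice_family_interval: "lattice_family V {Y. X \<subseteq> Y \<and> Y \<subseteq> V}"
  by (auto simp: lattice_family_def)

lemma lattice_input_probe:
  assumes "lattice_input n D a tb is \<noteq> lattice_input n D' a' tb is"
    and "greatest_set D = greatest_set D'" "preord D = preord D'"
  shows "\<exists>i. is = [i] \<and> (tb = Weight \<and> a (nat i) \<noteq> a' (nat i) \<or>
    tb = Least \<and> (nat i \<in> least_set D) \<noteq> (nat i \<in> least_set D'))"
  using assms by (cases "(n, D, a, tb, is)" rule: lattice_input.cases) (auto split: if_splits)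

text \<open>
  An adversary argument: the run on \<open>{V}\<close> with unit weights outputs \<open>n\<close>. If it overlooked a weight,
  that weight could be 2; if it neither read whether \<open>j\<close> is in the least set nor asked about
  \<open>V - {j}\<close>, the family could be \<open>{V - {j}, V}\<close>. In both cases the minimum changes unnoticed.
\<close>
lemma minimiser_time_lower_bound:
  assumes "minimises_within M n T"
  shows "2 * n + 1 \<le> T"
proof -
  let ?V = "{..<n}"
  let ?D = "\<lambda>X. \<lparr>least_set = X, greatest_set = ?V, preord = Id_on ?V\<rparr>"
  let ?L = "\<lambda>X. {Y. X \<subseteq> Y \<and> Y \<subseteq> ?V}"
  let ?one = "\<lambda>_. 1 :: int"
  have run: "\<exists>t\<le>T. computes_in M (lattice_input n (?D X) a) (lattice_oracle n (?L X)) t [Min (modular a ` ?L X)]"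
    if "X \<subseteq> ?V" for X a
    using assms describes_interval[OF that] lattice_family_interval[of ?V X]
    unfolding minimises_within_def by blast
  have LV: "?L ?V = {?V}" by auto
  have out_V: "Min (modular a ` ?L ?V) = (\<Sum>v<n. a v)" for a
    unfolding LV by (simp add: modular_def)
  obtain t s where t: "t \<le> T"
    "exec (lattice_input n (?D ?V) ?one) (lattice_oracle n (?L ?V)) M initial t s" "out s = [int n]"
    using run[of ?V ?one] unfolding out_V computes_in_def by auto
  obtain A B where AB: "finite A" "finite B" "length (out s) + card A + card B \<le> t"
    and transfer: "\<And>inp' orc'. agree A B (lattice_input n (?D ?V) ?one) (lattice_oracle n (?L ?V)) inp' orc'
      \<Longrightarrow> exec inp' orc' M initial t s"
    using exec_probes[OF t(2)] by (auto simp: initial_def)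
  have indist: False
    if X: "X \<subseteq> ?V" and "Min (modular a ` ?L X) \<noteq> int n"
      and "agree A B (lattice_input n (?D ?V) ?one) (lattice_oracle n (?L ?V))
             (lattice_input n (?D X) a) (lattice_oracle n (?L X))" for X a
    using run[OF X, of a] transfer[OF that(3)] exec_deterministic t(3) that(2)
    unfolding computes_in_def by fastforce
  \<comment> \<open>Different \<open>j\<close> need different probes, and an entry of the weights is not one of the least set.\<close>
  let ?AW = "A \<inter> ({Weight} \<times> UNIV)" and ?AL = "A \<inter> ({Least} \<times> UNIV)"
  have weights: "?V \<subseteq> (\<lambda>(tb, is). nat (hd is)) ` ?AW"
  proof
    fix j assume j: "j \<in> ?V"
    show "j \<in> (\<lambda>(tb, is). nat (hd is)) ` ?AW"
    proof (rule ccontr)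
      assume not: "j \<notin> (\<lambda>(tb, is). nat (hd is)) ` ?AW"
      have "(\<Sum>v<n. (?one(j := 2)) v) = (\<Sum>v<n. 1 + of_bool (v = j))"
        by (intro sum.cong) auto
      also have "\<dots> = int n + 1"
        using j by (simp add: sum.distrib of_bool_def sum.delta)
      finally have "Min (modular (?one(j := 2)) ` ?L ?V) \<noteq> int n" unfolding out_V by simp
      moreover have "agree A B (lattice_input n (?D ?V) ?one) (lattice_oracle n (?L ?V))
             (lattice_input n (?D ?V) (?one(j := 2))) (lattice_oracle n (?L ?V))"
        unfolding agree_def
      proof (clarsimp)
        fix tb "is" assume mem: "(tb, is) \<in> A"
        show "lattice_input n (?D ?V) (?one(j := 2)) tb is = lattice_input n (?D ?V) ?one tb is"
        proof (rule ccontr)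
          assume "\<not> ?thesis"
          then obtain i where "tb = Weight" "is = [i]" "nat i = j"
            by (auto dest!: lattice_input_probe split: if_splits)
          then show False using not mem by force
        qed
      qed
      ultimately show False using indist[of ?V] by blast
    qed
  qed
  have leasts: "?V \<subseteq> (\<lambda>(tb, is). nat (hd is)) ` ?AL \<union> (\<lambda>X. THE j. j < n \<and> X \<inter> ?V = ?V - {j}) ` B"
  proof
    fix j assume j: "j \<in> ?V"
    show "j \<in> (\<lambda>(tb, is). nat (hd is)) ` ?AL \<union> (\<lambda>X. THE j. j < n \<and> X \<inter> ?V = ?V - {j}) ` B"
    proof (rule ccontr)
      assume not: "\<not> ?thesis"
      let ?X = "?V - {j}"
      have LX: "?L ?X = {?X, ?V}" using j by auto
      have "modular ?one ?X = int n - 1" using j by (simp add: modular_def card_Diff_singleton)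
      then have "Min (modular ?one ` ?L ?X) \<noteq> int n" unfolding LX by (simp add: modular_def min_def)
      moreover have "agree A B (lattice_input n (?D ?V) ?one) (lattice_oracle n (?L ?V))
             (lattice_input n (?D ?X) ?one) (lattice_oracle n (?L ?X))"
        unfolding agree_def
      proof (intro conjI ballI; clarify?)
        fix tb "is" assume mem: "(tb, is) \<in> A"
        show "lattice_input n (?D ?X) ?one tb is = lattice_input n (?D ?V) ?one tb is"
        proof (rule ccontr)
          assume "\<not> ?thesis"
          then obtain i where "tb = Least" "is = [i]" "nat i = j"
            by (auto dest!: lattice_input_probe)
          then show False using not mem by force
        qed
      next
        fix X assume X: "X \<in> B"
        have "X \<inter> ?V \<noteq> ?X"
        proof
          assume eq: "X \<inter> ?V = ?X"
          have "(THE j. j < n \<and> X \<inter> ?V = ?V - {j}) = j"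
            using j unfolding eq by (intro the_equality) auto
          then show False using not X by force
        qed
        then show "lattice_oracle n (?L ?X) X = lattice_oracle n (?L ?V) X"
          unfolding lattice_oracle_def LX LV by simp
      qed
      ultimately show False using indist[of ?X] by blast
    qed
  qed
  have "n \<le> card ?AW"
    using surj_card_le[OF _ weights] AB(1) by simp
  moreover have "n \<le> card ?AL + card B"
  proof -
    have "n \<le> card ((\<lambda>(tb, is). nat (hd is)) ` ?AL \<union> (\<lambda>X. THE j. j < n \<and> X \<inter> ?V = ?V - {j}) ` B)"
      using card_mono[OF _ leasts] AB by simp
    also have "\<dots> \<le> card ?AL + card B"
      using AB by (intro order_trans[OF card_Un_le] add_mono card_image_le) auto
    finally show ?thesis .
  qed
  moreover have "card ?AW + card ?AL \<le> card A"
    using AB(1) by (subst card_Un_disjoint[symmetric]) (auto intro!: card_mono)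
  ultimately show ?thesis using AB(3) t(1,3) by simp
qed

section \<open>Forced elements and the descriptions\<close>

lemma describes_bounds:
  assumes "describes V (Some D) L"
  shows "least_set D \<in> L" "greatest_set D \<in> L" "\<And>X. X \<in> L \<Longrightarrow> least_set D \<subseteq> X \<and> X \<subseteq> greatest_set D"
proof -
  have L: "L = {X. least_set D \<subseteq> X \<and> X \<subseteq> greatest_set D \<and> (\<forall>(x, y)\<in>preord D. x \<in> X \<longrightarrow> y \<in> X)}"
    and "least_set D \<in> L" "greatest_set D \<in> L"
    using assms unfolding describes.simps by blast+
  then show "least_set D \<in> L" "greatest_set D \<in> L" by auto
  show "least_set D \<subseteq> X \<and> X \<subseteq> greatest_set D" if "X \<in> L" for X
    using that unfolding L by blast
qed

text \<open>
  A set that forces \<open>v\<close> consists of \<open>v\<close> and negative elements, hence omits \<open>w\<close>; the least member of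
  \<open>F\<^sub>v\<^sub>w\<close> is contained in it and forces \<open>v\<close> too.
\<close>
lemma forced_Plus_iff_least:
  assumes F: "F \<subseteq> Pow V" and d: "describes V D (separating_subfamily F v w)"
    and w: "w \<noteq> v" "\<sigma> w \<noteq> Some Minus"
  shows "forced V F \<sigma> v Plus \<longleftrightarrow>
    (\<exists>D'. D = Some D' \<and> (\<forall>k\<in>V. k \<noteq> v \<longrightarrow> k \<in> least_set D' \<longrightarrow> \<sigma> k = Some Minus))"
proof
  assume "forced V F \<sigma> v Plus"
  then obtain U where U: "U \<in> F" "v \<in> U" "\<forall>k\<in>U - {v}. \<sigma> k = Some Minus"
    by (auto simp: forced_def)
  then have "U \<in> separating_subfamily F v w" using w by (auto simp: separating_subfamily_def)
  then obtain D' where "D = Some D'" "least_set D' \<subseteq> U"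
    using d by (cases D) (simp, metis describes_bounds(3))
  then show "\<exists>D'. D = Some D' \<and> (\<forall>k\<in>V. k \<noteq> v \<longrightarrow> k \<in> least_set D' \<longrightarrow> \<sigma> k = Some Minus)"
    using U(3) by auto
next
  assume "\<exists>D'. D = Some D' \<and> (\<forall>k\<in>V. k \<noteq> v \<longrightarrow> k \<in> least_set D' \<longrightarrow> \<sigma> k = Some Minus)"
  then obtain D' where D: "D = Some D'" "\<forall>k\<in>V. k \<noteq> v \<longrightarrow> k \<in> least_set D' \<longrightarrow> \<sigma> k = Some Minus"
    by blast
  have "least_set D' \<in> separating_subfamily F v w" using describes_bounds d D(1) by blast
  then have "least_set D' \<in> F" "v \<in> least_set D'" by (auto simp: separating_subfamily_def)
  moreover have "least_set D' \<subseteq> V" using F \<open>least_set D' \<in> F\<close> by auto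
  ultimately show "forced V F \<sigma> v Plus" using D(2) by (auto simp: forced_def)
qed

text \<open>
  Dually, a set that forces \<open>v\<close> to be negative contains every element other than \<open>v\<close> that is not
  positive, in particular \<open>q\<close>.
\<close>
lemma forced_Minus_iff_greatest:
  assumes F: "F \<subseteq> Pow V" and d: "describes V D (separating_subfamily F q v)"
    and q: "q \<in> V" "q \<noteq> v" "\<sigma> q \<noteq> Some Plus"
  shows "forced V F \<sigma> v Minus \<longleftrightarrow>
    (\<exists>D'. D = Some D' \<and> (\<forall>k\<in>V. k \<noteq> v \<longrightarrow> k \<notin> greatest_set D' \<longrightarrow> \<sigma> k = Some Plus))"
proof
  assume "forced V F \<sigma> v Minus"
  then obtain W where W: "W \<in> F" "v \<notin> W" "\<forall>k\<in>V - (W \<union> {v}). \<sigma> k = Some Plus"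
    by (auto simp: forced_def)
  then have "W \<in> separating_subfamily F q v" using q by (auto simp: separating_subfamily_def)
  then obtain D' where "D = Some D'" "W \<subseteq> greatest_set D'"
    using d by (cases D) (simp, metis describes_bounds(3))
  then show "\<exists>D'. D = Some D' \<and> (\<forall>k\<in>V. k \<noteq> v \<longrightarrow> k \<notin> greatest_set D' \<longrightarrow> \<sigma> k = Some Plus)"
    using W(3) by auto
next
  assume "\<exists>D'. D = Some D' \<and> (\<forall>k\<in>V. k \<noteq> v \<longrightarrow> k \<notin> greatest_set D' \<longrightarrow> \<sigma> k = Some Plus)"
  then obtain D' where D: "D = Some D'" "\<forall>k\<in>V. k \<noteq> v \<longrightarrow> k \<notin> greatest_set D' \<longrightarrow> \<sigma> k = Some Plus"
    by blast
  have "greatest_set D' \<in> separating_subfamily F q v" using describes_bounds d D(1) by blast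
  then have "greatest_set D' \<in> F" "v \<notin> greatest_set D'" by (auto simp: separating_subfamily_def)
  then show "forced V F \<sigma> v Minus" using D(2) by (auto simp: forced_def)
qed

lemma trivially_forced_if_no_Minus:
  assumes "forced V F \<sigma> v Plus" "\<And>w. \<sigma> w \<noteq> Some Minus"
  shows "trivially_forced V F v Plus"
proof -
  obtain U where "U \<in> F" "v \<in> U" "\<forall>w\<in>U - {v}. \<sigma> w = Some Minus"
    using assms(1) by (auto simp: forced_def)
  moreover from this have "U = {v}" using assms(2) by blast
  ultimately show ?thesis by (simp add: trivially_forced_def)
qed

lemma cfa_stepI:
  assumes "v \<in> V" "\<sigma> v = None"
    and "\<forall>w\<in>V. \<sigma> w = None \<longrightarrow> (\<forall>r. \<not> trivially_forced V F w r)"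
    and forced: "\<exists>w\<in>V. \<sigma> w = None \<and> (\<exists>r. forced V F \<sigma> w r) \<Longrightarrow> forced V F \<sigma> v s"
  shows "cfa_step V F \<sigma> v s"
proof -
  have no: "\<not> (\<exists>w\<in>V. \<sigma> w = None \<and> (\<exists>r. trivially_forced V F w r))" using assms(3) by blast
  show ?thesis
    unfolding cfa_step_def if_not_P[OF no] using assms(1,2) forced
    by (cases "\<exists>w\<in>V. \<sigma> w = None \<and> (\<exists>r. forced V F \<sigma> w r)") (simp_all only: if_True if_False simp_thms)
qed

lemma cfa_step_default:
  assumes "v \<in> V" "\<sigma> v = None"
    and "\<forall>w\<in>V. \<sigma> w = None \<longrightarrow> (\<forall>r. \<not> trivially_forced V F w r)"
    and "\<And>w r. w \<in> V \<Longrightarrow> \<sigma> w = None \<Longrightarrow> w \<noteq> v \<Longrightarrow> \<not> forced V F \<sigma> w r"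
    and "\<And>r. r \<noteq> s \<Longrightarrow> \<not> forced V F \<sigma> v r"
  shows "cfa_step V F \<sigma> v s"
proof (rule cfa_stepI[OF assms(1-3)])
  assume "\<exists>w\<in>V. \<sigma> w = None \<and> (\<exists>r. forced V F \<sigma> w r)"
  then obtain w r where w: "w \<in> V" "\<sigma> w = None" "forced V F \<sigma> w r" by blast
  then have "w = v" using assms(4) by blast
  then show "forced V F \<sigma> v s" using w(3) assms(5)[of r] by blast
qed

lemma cfa_step_trivial:
  assumes "v \<in> V" "\<sigma> v = None" "trivially_forced V F v s"
  shows "cfa_step V F \<sigma> v s"
proof -
  have "\<exists>w\<in>V. \<sigma> w = None \<and> (\<exists>r. trivially_forced V F w r)" using assms by blast
  then show ?thesis unfolding cfa_step_def using assms by simp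
qed

lemma cfa_step_empty_family: "v \<in> V \<Longrightarrow> \<sigma> v = None \<Longrightarrow> cfa_step V {} \<sigma> v s"
proof -
  assume "v \<in> V" "\<sigma> v = None"
  moreover have "\<not> trivially_forced V {} w r" "\<not> forced V {} \<sigma> w r" for w r
    by (cases r; simp add: trivially_forced_def forced_def)+
  ultimately show ?thesis by (simp add: cfa_step_def)
qed

text \<open>
  Members of \<open>F\<close> are singletons here, so a nonempty \<open>F\<close> forces both elements trivially.
\<close>
lemma cfa_run_two_elements:
  assumes hyp: "cosigning_hypotheses V F" and V: "V = {a, b}" "a \<noteq> b"
  shows "{a} \<in> F \<Longrightarrow> cfa_run V F [(a, Plus), (b, Minus)]"
    and "{a} \<notin> F \<Longrightarrow> cfa_run V F [(a, Minus), (b, Plus)]"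
proof -
  have diff: "V - {a} = {b}" "V - {b} = {a}" using V by auto
  {
    assume "{a} \<in> F"
    then have "trivially_forced V F a Plus" "trivially_forced V F b Minus"
      by (simp_all add: trivially_forced_def diff)
    then show "cfa_run V F [(a, Plus), (b, Minus)]"
      using V by (simp add: cfa_step_trivial)
  next
    assume a: "{a} \<notin> F"
    show "cfa_run V F [(a, Minus), (b, Plus)]"
    proof (cases "{b} \<in> F")
      case True
      then have "trivially_forced V F b Plus" "trivially_forced V F a Minus"
        by (simp_all add: trivially_forced_def diff)
      then show ?thesis using V by (simp add: cfa_step_trivial)
    next
      case False
      have "F \<subseteq> Pow {a, b} - {{}, {a, b}}" using hyp V by (simp add: cosigning_hypotheses_def)
      then have "F \<subseteq> {{a}, {b}}" by (auto simp: Pow_insert)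
      then have "F = {}" using a False by auto
      then show ?thesis using V by (simp add: cfa_step_empty_family)
    qed
  }
qed

section \<open>Total correctness with time credits\<close>

text \<open>
  The postcondition also speaks about the time credit that is left over from the initial credit \<open>f\<close>.
  Thus the rules for loop-free programs are equations that the simplifier can execute, and a time bound
  is proved by the same invariant as functional correctness.
\<close>
definition wp :: "input \<Rightarrow> set_oracle \<Rightarrow> program \<Rightarrow> state \<Rightarrow> nat \<Rightarrow> (state \<Rightarrow> nat \<Rightarrow> bool) \<Rightarrow> bool" where
  "wp inp orc c s f Q \<longleftrightarrow> (\<exists>t s'. exec inp orc c s t s' \<and> t \<le> f \<and> Q s' (f - t))"

definition skip :: program where "skip = Do (Copy 0 (Reg 0))"

fun block :: "program list \<Rightarrow> program" where
  "block [] = skip"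
| "block [c] = c"
| "block (c # c' # cs) = Seq c (block (c' # cs))"

inductive_cases exec_DoE: "exec inp orc (Do i) s t s'"
inductive_cases exec_SeqE: "exec inp orc (Seq c c') s t s'"
inductive_cases exec_CondE: "exec inp orc (Cond b c c') s t s'"

lemma wp_Do: "wp inp orc (Do i) s f Q \<longleftrightarrow> 1 \<le> f \<and> Q (perform inp orc i s) (f - 1)"
  unfolding wp_def by (metis exec_Do exec_DoE)

lemma set_reg_same [simp]: "set_reg x (regs s x) s = s"
  by (simp add: set_reg_def)

lemma wp_skip: "wp inp orc skip s f Q \<longleftrightarrow> 1 \<le> f \<and> Q s (f - 1)"
  by (simp add: skip_def wp_Do)

lemma wp_Seq: "wp inp orc (Seq c c') s f Q \<longleftrightarrow> wp inp orc c s f (\<lambda>s' f'. wp inp orc c' s' f' Q)"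
proof
  assume "wp inp orc (Seq c c') s f Q"
  then obtain t u s' s'' where "exec inp orc c s t s'" "exec inp orc c' s' u s''" "t + u \<le> f" "Q s'' (f - (t + u))"
    unfolding wp_def by (auto elim: exec_SeqE)
  then show "wp inp orc c s f (\<lambda>s' f'. wp inp orc c' s' f' Q)"
    unfolding wp_def by (intro exI[of _ t] exI[of _ s'] conjI exI[of _ u] exI[of _ s'']) auto
next
  assume "wp inp orc c s f (\<lambda>s' f'. wp inp orc c' s' f' Q)"
  then obtain t u s' s'' where *: "exec inp orc c s t s'" "exec inp orc c' s' u s''" "t \<le> f" "u \<le> f - t" "Q s'' (f - t - u)"
    unfolding wp_def by auto
  then show "wp inp orc (Seq c c') s f Q"
    unfolding wp_def by (intro exI[of _ "t + u"] exI[of _ s'']) (auto intro: exec_Seq)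
qed

lemma wp_Cond: "wp inp orc (Cond b c c') s f Q \<longleftrightarrow>
    1 \<le> f \<and> (if test_val s b then wp inp orc c s (f - 1) Q else wp inp orc c' s (f - 1) Q)"
proof
  assume "wp inp orc (Cond b c c') s f Q"
  then obtain t s' where e: "exec inp orc (Cond b c c') s t s'" and t: "t \<le> f" "Q s' (f - t)"
    unfolding wp_def by auto
  from e show "1 \<le> f \<and> (if test_val s b then wp inp orc c s (f - 1) Q else wp inp orc c' s (f - 1) Q)"
    by (rule exec_CondE) (use t in \<open>fastforce simp: wp_def\<close>)+
next
  assume R: "1 \<le> f \<and> (if test_val s b then wp inp orc c s (f - 1) Q else wp inp orc c' s (f - 1) Q)"
  then obtain t s' where "if test_val s b then exec inp orc c s t s' else exec inp orc c' s t s'"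
      "t \<le> f - 1" "Q s' (f - 1 - t)"
    unfolding wp_def by (auto split: if_splits)
  then show "wp inp orc (Cond b c c') s f Q"
    using R unfolding wp_def
    by (intro exI[of _ "1 + t"] exI[of _ s'] conjI)
      (auto split: if_splits intro: exec_CondT[simplified] exec_CondF[simplified])
qed

text \<open>
  No termination measure is needed, since each iteration consumes credit.
\<close>
lemma wp_While:
  assumes "I s f"
    and step: "\<And>s f. I s f \<Longrightarrow> 1 \<le> f \<and> (if test_val s b then wp inp orc c s (f - 1) I else Q s (f - 1))"
  shows "wp inp orc (While b c) s f Q"
  using assms(1)
proof (induction f arbitrary: s rule: less_induct)
  case (less f)
  note now = step[OF less.prems]
  show ?case
  proof (cases "test_val s b")
    case True
    then obtain t s' where body: "exec inp orc c s t s'" "t \<le> f - 1" "I s' (f - 1 - t)"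
      using now unfolding wp_def by auto
    have "f - 1 - t < f" using now by simp
    from less.IH[OF this body(3)]
    obtain u s'' where rest: "exec inp orc (While b c) s' u s''" "u \<le> f - 1 - t" "Q s'' (f - 1 - t - u)"
      unfolding wp_def by blast
    show ?thesis
      unfolding wp_def
      using exec_WhileT[OF True body(1) rest(1)] rest(2,3) body(2) now
      by (intro exI[of _ "1 + t + u"] exI[of _ s'']) auto
  next
    case False
    then show ?thesis
      using now exec_WhileF[OF False, of inp orc c] unfolding wp_def
      by (intro exI[of _ 1] exI[of _ s]) auto
  qed
qed

lemmas wp_simps = wp_Do wp_skip wp_Seq wp_Cond

lemma regs_set_reg [simp]: "regs (set_reg x c s) = (regs s)(x := c)"
  and arrays_set_reg [simp]: "arrays (set_reg x c s) = arrays s"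
  and out_set_reg [simp]: "out (set_reg x c s) = out s"
  by (simp_all add: set_reg_def)

section \<open>The program\<close>

text \<open>
  In the terms of the introduction, \<open>last_reg\<close> holds \<open>z\<close> and \<open>neg_reg\<close> holds \<open>q\<close>. The candidate is compared
  with the element in \<open>scan_reg\<close> while it is examined, and \<open>sign_reg\<close> is 0 until a sign has been found.
  Registers up to \<open>sign_reg\<close> survive the examination of a candidate.
\<close>
abbreviation (input) size_reg :: nat where "size_reg \<equiv> 0"
abbreviation (input) open_reg :: nat where "open_reg \<equiv> 1"
abbreviation (input) neg_reg :: nat where "neg_reg \<equiv> 2"
abbreviation (input) idx_reg :: nat where "idx_reg \<equiv> 3"
abbreviation (input) last_reg :: nat where "last_reg \<equiv> 4"
abbreviation (input) cand_reg :: nat where "cand_reg \<equiv> 5"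
abbreviation (input) sign_reg :: nat where "sign_reg \<equiv> 6"
abbreviation (input) scan_reg :: nat where "scan_reg \<equiv> 7"
abbreviation (input) plus_reg :: nat where "plus_reg \<equiv> 8"
abbreviation (input) minus_reg :: nat where "minus_reg \<equiv> 9"
abbreviation (input) tmp_reg :: nat where "tmp_reg \<equiv> 10"
abbreviation (input) aux_reg :: nat where "aux_reg \<equiv> 11"

text \<open>
  Between two queries \<open>single\<close> is the empty set and \<open>rest\<close> the whole ground set, so a query about a
  singleton or its complement takes constant time. In \<open>signs\<close>, 0 means unsigned.
\<close>
abbreviation (input) signs :: nat where "signs \<equiv> 0"
abbreviation (input) single :: nat where "single \<equiv> 1"
abbreviation (input) rest :: nat where "rest \<equiv> 2"
abbreviation (input) todo :: nat where "todo \<equiv> 3"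

text \<open>
  One row of \<open>Least\<close> at \<open>(v, z)\<close> and one row of \<open>Greatest\<close> at \<open>(q, v)\<close> are scanned together. Only the
  entry of the candidate itself is passed over.
\<close>
definition inspect_body :: program where
  "inspect_body = block [
     Cond (Equal (Reg scan_reg) (Reg cand_reg)) skip (block [
       Do (Load aux_reg signs (Reg scan_reg)),
       Cond (Equal (Reg aux_reg) (Const (- 1))) skip (block [
         Do (Read tmp_reg Least [Reg cand_reg, Reg last_reg, Reg scan_reg]),
         Cond (Equal (Reg tmp_reg) (Const 1)) (Do (Copy plus_reg (Const 0))) skip]),
       Cond (Equal (Reg aux_reg) (Const 1)) skip (block [
         Do (Read tmp_reg Greatest [Reg neg_reg, Reg cand_reg, Reg scan_reg]),
         Cond (Equal (Reg tmp_reg) (Const 0)) (Do (Copy minus_reg (Const 0))) skip])]),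
     Do (Add scan_reg (Reg scan_reg) (Const 1))]"

definition inspect :: program where
  "inspect = block [
     Do (Read plus_reg Nonempty [Reg cand_reg, Reg last_reg]),
     Do (Read minus_reg Nonempty [Reg neg_reg, Reg cand_reg]),
     Do (Copy scan_reg (Const 0)),
     While (Less (Reg scan_reg) (Reg size_reg)) inspect_body]"

text \<open>
  Reaching \<open>z\<close> means that no other element is forced, so \<open>z\<close> counts as positive unless it must or, as its
  own witness, may be negative. This also ends the search.
\<close>
definition decide :: program where
  "decide = block [
     Cond (Equal (Reg cand_reg) (Reg last_reg))
       (block [Do (Copy plus_reg (Const 1)), Cond (Equal (Reg neg_reg) (Reg last_reg)) (Do (Copy minus_reg (Const 1))) skip])
       skip,
     Cond (Equal (Reg minus_reg) (Const 1)) (Do (Copy sign_reg (Const (- 1))))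
       (Cond (Equal (Reg plus_reg) (Const 1)) (Do (Copy sign_reg (Const 1)))
         (Do (Add idx_reg (Reg idx_reg) (Const 1))))]"

definition search_body :: program where
  "search_body = block [
     Do (Load cand_reg todo (Reg idx_reg)),
     inspect,
     decide]"

definition prepare :: program where
  "prepare = block [
     Do (Sub open_reg (Reg open_reg) (Const 1)),
     Do (Load last_reg todo (Reg open_reg)),
     Do (Load aux_reg signs (Reg neg_reg)),
     Cond (Equal (Reg aux_reg) (Const (- 1))) skip (Do (Copy neg_reg (Reg last_reg))),
     Do (Copy idx_reg (Const 0)),
     Do (Copy sign_reg (Const 0))]"

text \<open>
  The array of unsigned elements is kept gap-free by moving \<open>z\<close> to the place of the signed element.
\<close>
definition record_sign :: program where
  "record_sign = block [
     Do (Store todo (Reg idx_reg) (Reg last_reg)),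
     Do (Store signs (Reg cand_reg) (Reg sign_reg)),
     Cond (Less (Reg sign_reg) (Const 0))
       (block [Do (Copy neg_reg (Reg cand_reg)), Do (Sub tmp_reg (Const (- 1)) (Reg cand_reg))])
       (Do (Add tmp_reg (Reg cand_reg) (Const 1))),
     Do (Emit (Reg tmp_reg))]"

definition sign_next :: program where
  "sign_next = block [prepare, While (Equal (Reg sign_reg) (Const 0)) search_body, record_sign]"

definition ask :: "nat \<Rightarrow> nat \<Rightarrow> int \<Rightarrow> program" where
  "ask x A c = block [
     Do (Store A (Reg idx_reg) (Const c)), Do (Query x A), Do (Store A (Reg idx_reg) (Const (1 - c)))]"

definition dispatch :: program where
  "dispatch =
     Cond (Equal (Reg tmp_reg) (Const 1))
       (block [Do (Store signs (Reg idx_reg) (Const 1)), Do (Add tmp_reg (Reg idx_reg) (Const 1)), Do (Emit (Reg tmp_reg))])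
       (Cond (Equal (Reg aux_reg) (Const 1))
         (block [Do (Store signs (Reg idx_reg) (Const (- 1))), Do (Copy neg_reg (Reg idx_reg)),
            Do (Sub tmp_reg (Const (- 1)) (Reg idx_reg)), Do (Emit (Reg tmp_reg))])
         (block [Do (Store todo (Reg open_reg) (Reg idx_reg)), Do (Add open_reg (Reg open_reg) (Const 1))]))"

definition test_trivial :: program where
  "test_trivial = block [ask tmp_reg single 1, ask aux_reg rest 0, dispatch, Do (Add idx_reg (Reg idx_reg) (Const 1))]"

text \<open>
  For at most two elements the general program would be too slow for the bound.
\<close>
definition sign_few :: program where
  "sign_few = Cond (Less (Reg size_reg) (Const 2))
     (Cond (Less (Reg size_reg) (Const 1)) skip (Do (Emit (Const 1))))
     (block [Do (Read tmp_reg Nonempty [Const 0, Const 1]),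
        Cond (Equal (Reg tmp_reg) (Const 1))
          (block [Do (Emit (Const 1)), Do (Emit (Const (- 2)))])
          (block [Do (Emit (Const (- 1))), Do (Emit (Const 2))])])"

definition forcing_program :: program where
  "forcing_program = block [
     Do (Read size_reg Size []),
     Cond (Less (Reg size_reg) (Const 3)) sign_few (block [
       While (Less (Reg idx_reg) (Reg size_reg)) (block [
         Do (Store rest (Reg idx_reg) (Const 1)), Do (Add idx_reg (Reg idx_reg) (Const 1))]),
       Do (Copy idx_reg (Const 0)),
       While (Less (Reg idx_reg) (Reg size_reg)) test_trivial,
       While (Less (Const 0) (Reg open_reg)) sign_next])]"

section \<open>Specifications of the auxiliary programs\<close>

lemma inspect_body_spec:
  assumes r: "regs s scan_reg = int j" "regs s cand_reg = int v" "regs s last_reg = int z" "regs s neg_reg = int q"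
    and ab: "regs s plus_reg = of_bool A" "regs s minus_reg = of_bool B"
    and f: "(if j = v then 3 else 11) \<le> f"
    and Q: "\<And>s' f'. \<lbrakk>arrays s' = arrays s; out s' = out s; \<forall>r\<le>sign_reg. regs s' r = regs s r;
       regs s' scan_reg = int (Suc j);
       regs s' plus_reg = of_bool (A \<and> (j \<noteq> v \<longrightarrow> inp Least [int v, int z, int j] = 1 \<longrightarrow> arrays s signs (int j) = - 1));
       regs s' minus_reg = of_bool (B \<and> (j \<noteq> v \<longrightarrow> inp Greatest [int q, int v, int j] = 0 \<longrightarrow> arrays s signs (int j) = 1));
       f \<le> f' + (if j = v then 3 else 11)\<rbrakk> \<Longrightarrow> Q s' f'"
  shows "wp inp orc inspect_body s f Q"
proof (cases "j = v")
  case True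
  then show ?thesis
    using r ab f by (auto simp: inspect_body_def wp_simps intro!: Q)
next
  case False
  have [simp]: "v \<noteq> j" using False by simp
  show ?thesis
    using False r ab f by (auto simp: inspect_body_def wp_simps intro!: Q)
qed

text \<open>
  An entry costs 12, that of the candidate only 4, and the rest of the program 4 in total, which gives
  \<open>12(n - 1) + 8 = 12n - 4\<close>.
\<close>
lemma inspect_spec:
  fixes n v z q :: nat
  assumes r: "regs s size_reg = int n" "regs s cand_reg = int v" "regs s last_reg = int z" "regs s neg_reg = int q" "v < n"
    and inp01: "inp Nonempty [int v, int z] \<in> {0, 1}" "inp Nonempty [int q, int v] \<in> {0, 1}"
    and f: "12 * n \<le> f + 4"
    and Q: "\<And>s' f'. \<lbrakk>arrays s' = arrays s; out s' = out s; \<forall>r\<le>sign_reg. regs s' r = regs s r;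
       regs s' plus_reg = of_bool (inp Nonempty [int v, int z] = 1 \<and>
         (\<forall>j<n. j \<noteq> v \<longrightarrow> inp Least [int v, int z, int j] = 1 \<longrightarrow> arrays s signs (int j) = - 1));
       regs s' minus_reg = of_bool (inp Nonempty [int q, int v] = 1 \<and>
         (\<forall>j<n. j \<noteq> v \<longrightarrow> inp Greatest [int q, int v, int j] = 0 \<longrightarrow> arrays s signs (int j) = 1));
       f + 4 \<le> f' + 12 * n\<rbrakk> \<Longrightarrow> Q s' f'"
  shows "wp inp orc inspect s f Q"
proof -
  let ?A = "\<lambda>i. inp Nonempty [int v, int z] = 1 \<and>
         (\<forall>j<i. j \<noteq> v \<longrightarrow> inp Least [int v, int z, int j] = 1 \<longrightarrow> arrays s signs (int j) = - 1)"
  let ?B = "\<lambda>i. inp Nonempty [int q, int v] = 1 \<and>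
         (\<forall>j<i. j \<noteq> v \<longrightarrow> inp Greatest [int q, int v, int j] = 0 \<longrightarrow> arrays s signs (int j) = 1)"
  \<comment> \<open>Until the scan has passed the candidate \<open>v\<close>, the 8 units saved there are still to come.\<close>
  define I :: "state \<Rightarrow> nat \<Rightarrow> bool" where "I = (\<lambda>s' f'. \<exists>j\<le>n. regs s' scan_reg = int j \<and> arrays s' = arrays s \<and> out s' = out s \<and>
      (\<forall>r\<le>sign_reg. regs s' r = regs s r) \<and> regs s' plus_reg = of_bool (?A j) \<and> regs s' minus_reg = of_bool (?B j) \<and>
      12 * (n - j) + 5 + f \<le> f' + 12 * n + (if j \<le> v then 8 else 0))"
  have loop: "wp inp orc (While (Less (Reg scan_reg) (Reg size_reg)) inspect_body) s' f' Q" if "I s' f'" for s' f'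
  proof (rule wp_While[where I = I, OF that])
    fix s' f' assume "I s' f'"
    then obtain j where j: "j \<le> n" "regs s' scan_reg = int j" and fr: "arrays s' = arrays s" "out s' = out s"
      "\<forall>r\<le>sign_reg. regs s' r = regs s r" and ab: "regs s' plus_reg = of_bool (?A j)" "regs s' minus_reg = of_bool (?B j)"
      and f': "12 * (n - j) + 5 + f \<le> f' + 12 * n + (if j \<le> v then 8 else 0)"
      unfolding I_def by auto
    have r': "regs s' size_reg = int n" "regs s' cand_reg = int v" "regs s' last_reg = int z" "regs s' neg_reg = int q"
      using fr(3) r by simp_all
    show "1 \<le> f' \<and> (if test_val s' (Less (Reg scan_reg) (Reg size_reg)) then wp inp orc inspect_body s' (f' - 1) I else Q s' (f' - 1))"
    proof (cases "j < n")
      case True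
      have "wp inp orc inspect_body s' (f' - 1) I"
      proof (rule inspect_body_spec[OF j(2) r'(2-4) ab])
        show "(if j = v then 3 else 11) \<le> f' - 1"
          using f f' True \<open>v < n\<close> by (auto split: if_splits)
        fix s'' :: state and f'' assume *: "arrays s'' = arrays s'" "out s'' = out s'" "\<forall>r\<le>sign_reg. regs s'' r = regs s' r"
          "regs s'' scan_reg = int (Suc j)"
          "regs s'' plus_reg = of_bool (?A j \<and> (j \<noteq> v \<longrightarrow> inp Least [int v, int z, int j] = 1 \<longrightarrow> arrays s' signs (int j) = - 1))"
          "regs s'' minus_reg = of_bool (?B j \<and> (j \<noteq> v \<longrightarrow> inp Greatest [int q, int v, int j] = 0 \<longrightarrow> arrays s' signs (int j) = 1))"
          "f' - 1 \<le> f'' + (if j = v then 3 else 11)"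
        have "12 * (n - Suc j) + 5 + f \<le> f'' + 12 * n + (if Suc j \<le> v then 8 else 0)"
          using *(7) f' f True \<open>v < n\<close> by (auto split: if_splits)
        moreover have "(?A j \<and> (j \<noteq> v \<longrightarrow> inp Least [int v, int z, int j] = 1 \<longrightarrow> arrays s signs (int j) = - 1)) = ?A (Suc j)"
          by (auto simp: less_Suc_eq)
        moreover have "(?B j \<and> (j \<noteq> v \<longrightarrow> inp Greatest [int q, int v, int j] = 0 \<longrightarrow> arrays s signs (int j) = 1)) = ?B (Suc j)"
          by (auto simp: less_Suc_eq)
        ultimately show "I s'' f''"
          unfolding I_def using * fr True by (intro exI[of _ "Suc j"]) simp
      qed
      then show ?thesis using True j r' f' f by (auto split: if_splits)
    next
      case False
      then have [simp]: "j = n" using j by simp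
      have "f + 4 \<le> f' - 1 + 12 * n" "1 \<le> f'" using f' f \<open>v < n\<close> by (auto split: if_splits)
      then show ?thesis using j r' fr ab by (auto intro!: Q)
    qed
  qed
  show ?thesis
    unfolding inspect_def using f r inp01
    by (auto simp: wp_simps intro!: loop) (auto simp: I_def)
qed

fun sign_code :: "sign option \<Rightarrow> int" where
  "sign_code None = 0" | "sign_code (Some Plus) = 1" | "sign_code (Some Minus) = - 1"

lemma sign_code_eq [simp]:
  "sign_code r = - 1 \<longleftrightarrow> r = Some Minus" "sign_code r = 1 \<longleftrightarrow> r = Some Plus"
  by (cases r rule: sign_code.cases; simp)+

lemma decide_spec:
  assumes "regs s cand_reg = int v" "regs s last_reg = int z" "regs s neg_reg = int q" "regs s idx_reg = int i"
    "regs s plus_reg = of_bool A" "regs s minus_reg = of_bool B" "regs s sign_reg = 0" "7 \<le> f"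
    and Q: "\<And>s' f'. \<lbrakk>arrays s' = arrays s; out s' = out s; \<forall>r\<le>cand_reg. r \<noteq> idx_reg \<longrightarrow> regs s' r = regs s r; f \<le> f' + 7;
       (B \<or> v = z \<and> q = z) \<and> regs s' sign_reg = sign_code (Some Minus) \<and> regs s' idx_reg = int i \<or>
       \<not> B \<and> \<not> (v = z \<and> q = z) \<and> (A \<or> v = z) \<and> regs s' sign_reg = sign_code (Some Plus) \<and> regs s' idx_reg = int i \<or>
       \<not> B \<and> \<not> A \<and> v \<noteq> z \<and> regs s' sign_reg = 0 \<and> regs s' idx_reg = int (Suc i)\<rbrakk> \<Longrightarrow> Q s' f'"
  shows "wp inp orc decide s f Q"
proof -
  have r: "regs s cand_reg = int v" "regs s last_reg = int z" "regs s neg_reg = int q" "regs s idx_reg = int i" "regs s sign_reg = 0"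
    using assms by simp_all
  show ?thesis
  proof (cases "v = z")
    case True
    show ?thesis
      using assms(5,6,8) r True
      by (cases "q = z"; cases B; simp add: decide_def wp_simps) (intro conjI; (rule Q)?; simp)+
  next
    case False
    show ?thesis
      using assms(5,6,8) r False
      by (cases A; cases B; simp add: decide_def wp_simps) (intro conjI; (rule Q)?; simp)+
  qed
qed

lemma ask_spec:
  assumes "regs s idx_reg = int i" "arrays s A (int i) = 1 - c" "x \<noteq> idx_reg" "3 \<le> f"
    and Q: "\<And>s' f'. \<lbrakk>arrays s' = arrays s; out s' = out s;
       regs s' = (regs s)(x := of_bool (orc {j. if j = i then c \<noteq> 0 else arrays s A (int j) \<noteq> 0})); f \<le> f' + 3\<rbrakk>
      \<Longrightarrow> Q s' f'"
  shows "wp inp orc (ask x A c) s f Q"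
proof -
  define B where "B = {j. if j = i then c \<noteq> 0 else arrays s A (int j) \<noteq> 0}"
  have B: "{j. ((arrays s A)(int i := c)) (int j) \<noteq> 0} = B" by (auto simp: B_def)
  let ?s = "s\<lparr>arrays := (arrays s)(A := (arrays s A)(int i := c))\<rparr>"
  have "wp inp orc (Do (Query x A)) ?s (f - 1)
     (\<lambda>s' f'. wp inp orc (Do (Store A (Reg idx_reg) (Const (1 - c)))) s' f' Q)"
  proof -
    have "Q (set_reg x (of_bool (orc B)) ?s\<lparr>arrays := (arrays s)(A := (arrays s A)(int i := 1 - c))\<rparr>) (f - Suc (Suc (Suc 0)))"
    proof (rule Q)
      have "(arrays s A)(int i := 1 - c) = arrays s A" using assms(2) by auto
      then show "arrays (set_reg x (of_bool (orc B)) ?s\<lparr>arrays := (arrays s)(A := (arrays s A)(int i := 1 - c))\<rparr>) = arrays s"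
        by simp
    qed (use assms in \<open>simp_all add: B_def\<close>)
    moreover have "perform inp orc (Query x A) ?s = set_reg x (of_bool (orc B)) ?s"
      by (simp add: B[symmetric])
    ultimately show ?thesis
      using assms(1,3,4) by (simp add: wp_simps set_reg_def del: perform.simps(7), arith)
  qed
  then show ?thesis using assms(1,4) by (simp add: ask_def wp_simps del: perform.simps(7))
qed

section \<open>The program on a given crossing family\<close>

lemma swap_remove:
  assumes "us = ys @ [z]" "i < length us" "distinct us"
  shows "distinct (butlast (us[i := z]))" "set (butlast (us[i := z])) = set us - {us ! i}"
proof -
  have "distinct (butlast (us[i := z])) \<and> set (butlast (us[i := z])) = set us - {us ! i}"
  proof (cases "i < length ys")
    case True
    define as bs where "as = take i ys" and "bs = drop (Suc i) ys"
    have "us ! i = ys ! i" using assms(1) True by (simp add: nth_append)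
    then have ys: "ys = as @ us ! i # bs" "i = length as"
      using id_take_nth_drop[OF True] True by (simp_all add: as_def bs_def)
    have us: "us = as @ us ! i # bs @ [z]" using assms(1) ys(1) by (metis append.assoc append_Cons)
    then have "us[i := z] = as @ z # bs @ [z]" using ys(2) by (metis list_update_length)
    then have "butlast (us[i := z]) = as @ z # bs" by (simp add: butlast_append)
    moreover have "distinct (as @ us ! i # bs @ [z])" using assms(3) us by metis
    moreover have "set us = set (as @ us ! i # bs @ [z])" using us by metis
    ultimately show ?thesis by auto
  next
    case False
    then have i: "i = length ys" using assms by simp
    then have "butlast (us[i := z]) = ys" using assms(1) by simp
    then show ?thesis using assms i by auto
  qed
  then show "distinct (butlast (us[i := z]))" "set (butlast (us[i := z])) = set us - {us ! i}" by auto
qed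

text \<open>
  Twice the running time of the program against twice \<open>2n\<^sup>3T\<close> at \<open>T = 2n + 1\<close>. At \<open>n = 3\<close>
  the two sides are 696 and 756, so there the constants matter.
\<close>
lemma cost_bound:
  assumes "3 \<le> (n::nat)"
  shows "(12 * n + 5) * (n * (n + 1)) + 64 * n + 12 \<le> 2 * (2 * n ^ 3 * (2 * n + 1))"
proof -
  obtain k where "n = k + 3" using assms by (metis le_Suc_ex add.commute)
  then show ?thesis by (simp add: algebra_simps power2_eq_square power3_eq_cube)
qed

locale cosigning_instance =
  fixes V :: "'a set" and F :: "'a set set" and d :: "'a \<Rightarrow> 'a \<Rightarrow> 'a description option"
    and e :: "nat \<Rightarrow> 'a" and n :: nat
  assumes hyp: "cosigning_hypotheses V F"
    and provided: "well_provided V F d"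
    and enum: "enumerates e V"
    and n_card: "n = card V"
begin

abbreviation "named xs \<equiv> map (\<lambda>(i, s). (e i, s)) (xs :: (nat \<times> sign) list)"
abbreviation "inp \<equiv> crossing_input n e d"
abbreviation "orc \<equiv> crossing_oracle n e F"
abbreviation "unsigned xs \<equiv> {j. j < n \<and> map_of xs j = (None :: sign option)}"
abbreviation "untrivial j \<equiv> \<forall>r. \<not> trivially_forced V F (e j) r"

lemma bij: "bij_betw e {..<n} V"
  using enum n_card by (simp add: enumerates_def)

lemma V_eq: "V = e ` {..<n}"
  using bij by (simp add: bij_betw_def)

lemma e_in [simp]: "i < n \<Longrightarrow> e i \<in> V"
  using V_eq by auto

lemma e_eq [simp]: "i < n \<Longrightarrow> j < n \<Longrightarrow> e i = e j \<longleftrightarrow> i = j"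
  using bij unfolding bij_betw_def inj_on_def by auto

lemma ball_V: "(\<forall>x\<in>V. P x) \<longleftrightarrow> (\<forall>i<n. P (e i))"
  using V_eq by auto

lemma F_sub: "F \<subseteq> Pow V"
  using hyp by (auto simp: cosigning_hypotheses_def)

lemma map_of_named: "fst ` set xs \<subseteq> {..<n} \<Longrightarrow> i < n \<Longrightarrow> map_of (named xs) (e i) = map_of xs i"
  by (induction xs) auto

lemma map_of_named_eq_Some:
  "fst ` set xs \<subseteq> {..<n} \<Longrightarrow> map_of (named xs) x = Some r \<Longrightarrow> \<exists>i<n. x = e i \<and> map_of xs i = Some r"
  by (induction xs) (auto split: if_splits)

lemma forced_Plus_iff_input:
  assumes "v < n" "z < n" "v \<noteq> z" "fst ` set xs \<subseteq> {..<n}" "map_of xs z \<noteq> Some Minus"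
  shows "forced V F (map_of (named xs)) (e v) Plus \<longleftrightarrow> inp Nonempty [int v, int z] = 1 \<and>
    (\<forall>j<n. j \<noteq> v \<longrightarrow> inp Least [int v, int z, int j] = 1 \<longrightarrow> map_of xs j = Some Minus)"
proof -
  have D: "describes V (d (e v) (e z)) (separating_subfamily F (e v) (e z))"
    using provided assms(1-3) by (simp add: well_provided_def)
  show ?thesis
    by (subst forced_Plus_iff_least[OF F_sub D])
      (use assms in \<open>auto simp: map_of_named ball_V\<close>)
qed

lemma forced_Minus_iff_input:
  assumes "v < n" "q < n" "v \<noteq> q" "fst ` set xs \<subseteq> {..<n}" "map_of xs q \<noteq> Some Plus"
  shows "forced V F (map_of (named xs)) (e v) Minus \<longleftrightarrow> inp Nonempty [int q, int v] = 1 \<and>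
    (\<forall>j<n. j \<noteq> v \<longrightarrow> inp Greatest [int q, int v, int j] = 0 \<longrightarrow> map_of xs j = Some Plus)"
proof -
  have D: "describes V (d (e q) (e v)) (separating_subfamily F (e q) (e v))"
    using provided assms(1-3) by (simp add: well_provided_def)
  show ?thesis
    by (subst forced_Minus_iff_greatest[OF F_sub D])
      (use assms in \<open>auto simp: map_of_named ball_V\<close>)
qed

text \<open>
  \<open>xs\<close> lists the numbered elements signed so far, \<open>us\<close> is the content of the array of unsigned elements
  and \<open>q\<close> the witness, which is negative as soon as any element is.
\<close>
definition tracks :: "(nat \<times> sign) list \<Rightarrow> nat list \<Rightarrow> nat \<Rightarrow> state \<Rightarrow> bool" where
  "tracks xs us q s \<longleftrightarrow>
     legal_prefix V F (named xs) \<and> out s = map literal xs \<and> regs s size_reg = int n \<and>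
     (\<forall>j<n. arrays s signs (int j) = sign_code (map_of xs j)) \<and>
     regs s neg_reg = int q \<and> q < n \<and> (map_of xs q = Some Minus \<or> (\<forall>j. map_of xs j \<noteq> Some Minus)) \<and>
     regs s open_reg = int (length us) \<and> (\<forall>j<length us. arrays s todo (int j) = int (us ! j))"

text \<open>
  After the first \<open>i\<close> elements have been tested for being trivially forced. The main phase works with
  \<open>i = n\<close>; then everything unsigned is known not to be trivially forced.
\<close>
definition queue :: "nat \<Rightarrow> (nat \<times> sign) list \<Rightarrow> nat list \<Rightarrow> bool" where
  "queue i xs us \<longleftrightarrow> i \<le> n \<and> fst ` set xs \<subseteq> {..<i} \<and> distinct us \<and>
     set us = {j. j < i \<and> map_of xs j = None} \<and> (\<forall>j\<in>set us. untrivial j)"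

lemma legal_named_snoc:
  assumes "legal_prefix V F (named xs)" "fst ` set xs \<subseteq> {..<n}" "v < n"
    and "cfa_step V F (map_of (named xs)) (e v) r"
  shows "legal_prefix V F (named (xs @ [(v, r)]))" "map_of xs v = None"
    "map_of (xs @ [(v, r)]) = (map_of xs)(v \<mapsto> r)"
proof -
  show "legal_prefix V F (named (xs @ [(v, r)]))" using legal_prefix_snoc[OF assms(1,4)] by simp
  show new: "map_of xs v = None" using cfa_step_new[OF assms(4)] assms(2,3) by (simp add: map_of_named)
  show "map_of (xs @ [(v, r)]) = (map_of xs)(v \<mapsto> r)" by (rule map_of_snoc[OF new])
qed

abbreviation "plus_entries xs v z \<equiv> inp Nonempty [int v, int z] = 1 \<and>
    (\<forall>j<n. j \<noteq> v \<longrightarrow> inp Least [int v, int z, int j] = 1 \<longrightarrow> map_of xs j = Some Minus)"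
abbreviation "minus_entries xs q v \<equiv> inp Nonempty [int q, int v] = 1 \<and>
    (\<forall>j<n. j \<noteq> v \<longrightarrow> inp Greatest [int q, int v, int j] = 0 \<longrightarrow> map_of xs j = Some Plus)"

text \<open>
  Why the decision is a legal step. For \<open>us ! i = z\<close> nothing else is forced, so it is enough that \<open>z\<close>
  is not forced to the opposite sign. If \<open>q = z\<close> there are no negative elements, and then forced to be
  positive means trivially forced.
\<close>
lemma search_verdict:
  assumes queue: "queue n xs us" and us: "length us = Suc m" "us ! m = z"
    and q: "q < n" "q = z \<and> (\<forall>j. map_of xs j \<noteq> Some Minus) \<or> map_of xs q = Some Minus"
    and i: "i \<le> m" and earlier: "\<And>j r. j < i \<Longrightarrow> \<not> forced V F (map_of (named xs)) (e (us ! j)) r"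
  shows "minus_entries xs q (us ! i) \<or> us ! i = z \<and> q = z \<Longrightarrow> cfa_step V F (map_of (named xs)) (e (us ! i)) Minus"
    and "\<not> minus_entries xs q (us ! i) \<Longrightarrow> \<not> (us ! i = z \<and> q = z) \<Longrightarrow> plus_entries xs (us ! i) z \<or> us ! i = z \<Longrightarrow>
      cfa_step V F (map_of (named xs)) (e (us ! i)) Plus"
    and "\<not> minus_entries xs q (us ! i) \<Longrightarrow> \<not> plus_entries xs (us ! i) z \<Longrightarrow> us ! i \<noteq> z \<Longrightarrow>
      \<not> forced V F (map_of (named xs)) (e (us ! i)) r"
proof -
  let ?\<sigma> = "map_of (named xs)" and ?v = "us ! i"
  have sub: "fst ` set xs \<subseteq> {..<n}" and dist: "distinct us" and set_us: "set us = unsigned xs"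
    and untriv: "\<forall>j\<in>set us. untrivial j"
    using queue by (auto simp: queue_def)
  have "?v \<in> set us" "z \<in> set us" using us i by auto
  then have v: "?v < n" "map_of xs ?v = None" and z: "z < n" "map_of xs z = None"
    using set_us by auto
  have \<sigma>v: "?\<sigma> (e ?v) = None" "e ?v \<in> V" using v map_of_named[OF sub] by auto
  have no_triv: "\<forall>w\<in>V. ?\<sigma> w = None \<longrightarrow> (\<forall>r. \<not> trivially_forced V F w r)"
    unfolding ball_V using untriv set_us map_of_named[OF sub] by auto
  have q_sign: "map_of xs q \<noteq> Some Plus" using q z by auto
  have minus: "minus_entries xs q ?v \<longleftrightarrow> forced V F ?\<sigma> (e ?v) Minus" if "\<not> (?v = z \<and> q = z)"
  proof -
    have "?v \<noteq> q" using that q v by auto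
    then show ?thesis using forced_Minus_iff_input[OF v(1) q(1) _ sub q_sign] by blast
  qed
  have plus: "plus_entries xs ?v z \<longleftrightarrow> forced V F ?\<sigma> (e ?v) Plus" if "?v \<noteq> z"
    using forced_Plus_iff_input[OF v(1) z(1) that sub] z(2) by simp
  have step_forced: "cfa_step V F ?\<sigma> (e ?v) r" if "forced V F ?\<sigma> (e ?v) r" for r
    by (rule cfa_stepI[OF \<sigma>v(2,1) no_triv that])
  have last: "\<not> forced V F ?\<sigma> w r" if "?v = z" and w: "w \<in> V" "?\<sigma> w = None" "w \<noteq> e ?v" for w r
  proof -
    have "i = m" using that(1) us i dist by (metis nth_eq_iff_index_eq lessI less_Suc_eq_le)
    obtain j where j: "j < n" "w = e j" using w(1) V_eq by auto
    then have "j \<in> set us" using w(2) j set_us map_of_named[OF sub] by auto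
    then obtain k where "k < Suc m" "j = us ! k" using us(1) by (metis in_set_conv_nth)
    then have "k < i" using w(3) \<open>w = e j\<close> \<open>i = m\<close> by (metis less_Suc_eq)
    then show ?thesis using earlier \<open>j = us ! k\<close> \<open>w = e j\<close> by blast
  qed
  have step_default: "cfa_step V F ?\<sigma> (e ?v) r" if "?v = z" "\<And>r'. r' \<noteq> r \<Longrightarrow> \<not> forced V F ?\<sigma> (e ?v) r'" for r
    by (rule cfa_step_default[OF \<sigma>v(2,1) no_triv last[OF that(1)] that(2)])
  {
    assume *: "minus_entries xs q ?v \<or> ?v = z \<and> q = z"
    show "cfa_step V F ?\<sigma> (e ?v) Minus"
    proof (cases "?v = z \<and> q = z")
      case True
      then have none: "map_of xs j \<noteq> Some Minus" for j using q z by auto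
      then have "?\<sigma> w \<noteq> Some Minus" for w using map_of_named_eq_Some[OF sub] by blast
      then have "\<not> forced V F ?\<sigma> (e ?v) Plus"
        using trivially_forced_if_no_Minus no_triv \<sigma>v by metis
      then have "\<not> forced V F ?\<sigma> (e ?v) r'" if "r' \<noteq> Minus" for r' using that by (cases r') simp_all
      then show ?thesis using step_default True by blast
    next
      case False
      then show ?thesis using * minus step_forced by blast
    qed
  next
    assume "\<not> minus_entries xs q ?v" "\<not> (?v = z \<and> q = z)" and p: "plus_entries xs ?v z \<or> ?v = z"
    then have nm: "\<not> forced V F ?\<sigma> (e ?v) Minus" using minus by blast
    show "cfa_step V F ?\<sigma> (e ?v) Plus"
    proof (cases "?v = z")
      case True
      have "\<not> forced V F ?\<sigma> (e ?v) r'" if "r' \<noteq> Plus" for r' using that nm by (cases r') simp_all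
      then show ?thesis using step_default True by blast
    next
      case False
      then show ?thesis using p plus step_forced by blast
    qed
  next
    assume "\<not> minus_entries xs q ?v" "\<not> plus_entries xs ?v z" "?v \<noteq> z"
    then show "\<not> forced V F ?\<sigma> (e ?v) r" using minus plus by (cases r) blast+
  }
qed

text \<open>
  One candidate costs at most \<open>12n + 5\<close>, and the search ends at \<open>z\<close> at the latest.
\<close>
lemma search_spec:
  assumes queue: "queue n xs us" and us: "length us = Suc m" "us ! m = z"
    and sg: "\<forall>j<n. arrays s signs (int j) = sign_code (map_of xs j)"
    and td: "\<forall>j<Suc m. arrays s todo (int j) = int (us ! j)"
    and r: "regs s size_reg = int n" "regs s neg_reg = int q" "regs s last_reg = int z" "regs s idx_reg = 0" "regs s sign_reg = 0"
    and q: "q < n" "q = z \<and> (\<forall>j. map_of xs j \<noteq> Some Minus) \<or> map_of xs q = Some Minus"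
    and f: "Suc m * (12 * n + 5) + 1 \<le> f"
    and Q: "\<And>s' f' i r. \<lbrakk>arrays s' = arrays s; out s' = out s;
        \<forall>r\<in>{size_reg, open_reg, neg_reg, last_reg}. regs s' r = regs s r;
        i \<le> m; regs s' idx_reg = int i; regs s' cand_reg = int (us ! i); regs s' sign_reg = sign_code (Some r);
        cfa_step V F (map_of (named xs)) (e (us ! i)) r; f \<le> f' + (Suc m * (12 * n + 5) + 1)\<rbrakk> \<Longrightarrow> Q s' f'"
  shows "wp inp orc (While (Equal (Reg sign_reg) (Const 0)) search_body) s f Q"
proof -
  define C where "C = 12 * n + 5"
  define frame where "frame = (\<lambda>s' :: state. arrays s' = arrays s \<and> out s' = out s \<and>
     (\<forall>r\<in>{size_reg, open_reg, neg_reg, last_reg}. regs s' r = regs s r))"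
  \<comment> \<open>While the sign register is 0, no candidate before the \<open>i\<close>-th is forced; once it is set, it is a legal sign for the \<open>i\<close>-th candidate.\<close>
  define I :: "state \<Rightarrow> nat \<Rightarrow> bool" where "I = (\<lambda>s' f'. frame s' \<and> (\<exists>i\<le>m. regs s' idx_reg = int i \<and>
     (regs s' sign_reg = 0 \<and> (\<forall>j<i. \<forall>r. \<not> forced V F (map_of (named xs)) (e (us ! j)) r) \<and>
        (Suc m - i) * C + f \<le> f' + Suc m * C \<or>
      (\<exists>r. regs s' cand_reg = int (us ! i) \<and> regs s' sign_reg = sign_code (Some r) \<and>
         cfa_step V F (map_of (named xs)) (e (us ! i)) r \<and> f \<le> f' + Suc m * C))))"
  note f = f[folded C_def]
  show ?thesis
  proof (rule wp_While[where I = I])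
    show "I s f" using r f by (auto simp: I_def frame_def intro!: exI[of _ 0])
    fix s' f' assume "I s' f'"
    then obtain i where fr: "frame s'" and i: "i \<le> m" "regs s' idx_reg = int i" and
      disj: "regs s' sign_reg = 0 \<and> (\<forall>j<i. \<forall>r. \<not> forced V F (map_of (named xs)) (e (us ! j)) r) \<and>
        (Suc m - i) * C + f \<le> f' + Suc m * C \<or>
       (\<exists>r. regs s' cand_reg = int (us ! i) \<and> regs s' sign_reg = sign_code (Some r) \<and>
         cfa_step V F (map_of (named xs)) (e (us ! i)) r \<and> f \<le> f' + Suc m * C)"
      unfolding I_def by blast
    show "1 \<le> f' \<and> (if test_val s' (Equal (Reg sign_reg) (Const 0)) then wp inp orc search_body s' (f' - 1) I else Q s' (f' - 1))"
    proof (cases "regs s' sign_reg = 0")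
      case False
      then obtain r where r: "regs s' cand_reg = int (us ! i)" "regs s' sign_reg = sign_code (Some r)"
         "cfa_step V F (map_of (named xs)) (e (us ! i)) r" "f \<le> f' + Suc m * C"
        using disj by blast
      have "Q s' (f' - 1)"
      proof (rule Q)
        show "f \<le> f' - 1 + (Suc m * (12 * n + 5) + 1)" using r(4) C_def by simp
      qed (use fr i r in \<open>auto simp: frame_def\<close>)
      then show ?thesis using False r(4) f by simp
    next
      case True
      have "sign_code (Some r) \<noteq> 0" for r by (cases r) simp_all
      then have earlier: "\<And>j r. j < i \<Longrightarrow> \<not> forced V F (map_of (named xs)) (e (us ! j)) r"
        and f': "(Suc m - i) * C + f \<le> f' + Suc m * C"
        using disj True by metis+
      have mi: "(Suc m - i) * C = C + (m - i) * C" using i by (simp add: Suc_diff_le)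
      let ?v = "us ! i"
      have "?v \<in> set us" using us(1) i(1) by simp
      then have v: "?v < n" using queue by (auto simp: queue_def)
      define s1 where "s1 = perform inp orc (Load cand_reg todo (Reg idx_reg)) s'"
      have s1: "frame s1" "regs s1 idx_reg = int i" "regs s1 cand_reg = int ?v" "regs s1 sign_reg = 0"
        using fr i td True by (simp_all add: s1_def frame_def)
      have r1: "regs s1 size_reg = int n" "regs s1 last_reg = int z" "regs s1 neg_reg = int q" "arrays s1 signs = arrays s signs"
        using s1(1) r by (simp_all add: frame_def)
      have "wp inp orc inspect s1 (f' - 1 - 1) (\<lambda>s2 f2. wp inp orc decide s2 f2 I)"
      proof (rule inspect_spec[OF r1(1) s1(3) r1(2,3) v])
        show "inp Nonempty [int ?v, int z] \<in> {0, 1}" "inp Nonempty [int q, int ?v] \<in> {0, 1}" by auto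
        show "12 * n \<le> f' - 1 - 1 + 4" using f' f mi C_def by simp
        fix s2 :: state and f2
        assume s2: "arrays s2 = arrays s1" "out s2 = out s1" "\<forall>r\<le>sign_reg. regs s2 r = regs s1 r"
          "regs s2 plus_reg = of_bool (inp Nonempty [int ?v, int z] = 1 \<and>
            (\<forall>j<n. j \<noteq> ?v \<longrightarrow> inp Least [int ?v, int z, int j] = 1 \<longrightarrow> arrays s1 signs (int j) = - 1))"
          "regs s2 minus_reg = of_bool (inp Nonempty [int q, int ?v] = 1 \<and>
            (\<forall>j<n. j \<noteq> ?v \<longrightarrow> inp Greatest [int q, int ?v, int j] = 0 \<longrightarrow> arrays s1 signs (int j) = 1))"
          "f' - 1 - 1 + 4 \<le> f2 + 12 * n"
        have ab: "regs s2 plus_reg = of_bool (plus_entries xs ?v z)" "regs s2 minus_reg = of_bool (minus_entries xs q ?v)"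
          unfolding s2(4,5) r1(4) using sg by (simp_all cong: conj_cong)
        have r2: "regs s2 cand_reg = int ?v" "regs s2 last_reg = int z" "regs s2 neg_reg = int q" "regs s2 idx_reg = int i" "regs s2 sign_reg = 0"
          using s2(3) s1 r1 by simp_all
        have f2: "7 + f + (m - i) * C \<le> f2 + Suc m * C"
          using s2(6) f' f mi C_def by simp
        have "(m - i) * C \<le> m * C" by simp
        show "wp inp orc decide s2 f2 I"
        proof (rule decide_spec[OF r2(1-4) ab r2(5)])
          show "7 \<le> f2" using f2 f by simp
          fix s3 :: state and f3
          assume s3: "arrays s3 = arrays s2" "out s3 = out s2" "\<forall>r\<le>cand_reg. r \<noteq> idx_reg \<longrightarrow> regs s3 r = regs s2 r" "f2 \<le> f3 + 7"
            and cases: "(minus_entries xs q ?v \<or> ?v = z \<and> q = z) \<and> regs s3 sign_reg = sign_code (Some Minus) \<and> regs s3 idx_reg = int i \<or>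
              \<not> minus_entries xs q ?v \<and> \<not> (?v = z \<and> q = z) \<and> (plus_entries xs ?v z \<or> ?v = z) \<and>
                regs s3 sign_reg = sign_code (Some Plus) \<and> regs s3 idx_reg = int i \<or>
              \<not> minus_entries xs q ?v \<and> \<not> plus_entries xs ?v z \<and> ?v \<noteq> z \<and> regs s3 sign_reg = 0 \<and> regs s3 idx_reg = int (Suc i)"
          have fr3: "frame s3" "regs s3 cand_reg = int ?v"
            using s1(1,3) s2(1-3) s3(1-3) by (simp_all add: frame_def)
          have f3: "f + (m - i) * C \<le> f3 + Suc m * C" using f2 s3(4) by simp
          note verdict = search_verdict[OF queue us q i(1) earlier]
          from cases consider (minus) "cfa_step V F (map_of (named xs)) (e ?v) Minus" "regs s3 sign_reg = sign_code (Some Minus)" "regs s3 idx_reg = int i"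
            | (plus) "cfa_step V F (map_of (named xs)) (e ?v) Plus" "regs s3 sign_reg = sign_code (Some Plus)" "regs s3 idx_reg = int i"
            | (none) "\<forall>r. \<not> forced V F (map_of (named xs)) (e ?v) r" "?v \<noteq> z" "regs s3 sign_reg = 0" "regs s3 idx_reg = int (Suc i)"
            using verdict by blast
          then show "I s3 f3"
          proof cases
            case none
            have "i < m" using none(2) us(2) i(1) by (metis le_neq_implies_less)
            moreover have "\<forall>j<Suc i. \<forall>r. \<not> forced V F (map_of (named xs)) (e (us ! j)) r"
              using earlier none(1) by (metis less_Suc_eq)
            ultimately show ?thesis
              unfolding I_def using fr3 none(3,4) f3 by (intro conjI exI[of _ "Suc i"] disjI1) simp_all
          next
            case minus
            then show ?thesis unfolding I_def using fr3 f3 i(1) by (intro conjI exI[of _ i] disjI2 exI[of _ Minus]) simp_all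
          next
            case plus
            then show ?thesis unfolding I_def using fr3 f3 i(1) by (intro conjI exI[of _ i] disjI2 exI[of _ Plus]) simp_all
          qed
        qed
      qed
      then have "wp inp orc search_body s' (f' - 1) I"
        using f' f mi by (simp add: search_body_def wp_simps s1_def C_def)
      then show ?thesis using True f' f mi by (simp add: C_def)
    qed
  qed
qed

lemma prepare_spec:
  assumes tr: "tracks xs us q s" and us: "length us = Suc m" "us ! m = z" and f: "7 \<le> f"
    and Q: "\<And>s' f'. \<lbrakk>arrays s' = arrays s; out s' = out s; regs s' size_reg = int n; regs s' open_reg = int m;
       regs s' neg_reg = int (if map_of xs q = Some Minus then q else z); regs s' last_reg = int z;
       regs s' idx_reg = 0; regs s' sign_reg = 0; f \<le> f' + 7\<rbrakk> \<Longrightarrow> Q s' f'"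
  shows "wp inp orc prepare s f Q"
proof -
  have r: "regs s 0 = int n" "regs s (Suc 0) = 1 + int m" "regs s 2 = int q" "q < n"
      "arrays s 0 (int q) = sign_code (map_of xs q)" "arrays s 3 (int m) = int z"
    using tr us by (simp_all add: tracks_def)
  show ?thesis
    using r f
    by (cases "map_of xs q = Some Minus"; simp add: prepare_def wp_simps)
      (intro conjI; (rule Q)?; simp)+
qed

lemma record_sign_spec:
  assumes r: "regs s idx_reg = int i" "regs s last_reg = int z" "regs s cand_reg = int v" "regs s sign_reg = sign_code (Some r)" "6 \<le> f"
    and Q: "\<And>s' f'. \<lbrakk>arrays s' = (arrays s)(todo := (arrays s todo)(int i := int z),
         signs := (arrays s signs)(int v := sign_code (Some r)));
       out s' = out s @ [literal (v, r)]; regs s' size_reg = regs s size_reg; regs s' open_reg = regs s open_reg;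
       regs s' neg_reg = (if r = Minus then int v else regs s neg_reg); f \<le> f' + 6\<rbrakk> \<Longrightarrow> Q s' f'"
  shows "wp inp orc record_sign s f Q"
  using r by (cases r; simp add: record_sign_def wp_simps) (intro conjI; (rule Q)?; simp)+

lemma sign_next_spec:
  assumes tr: "tracks xs us q s" and queue: "queue n xs us" and ne: "us \<noteq> []"
    and f: "length us * (12 * n + 5) + 14 \<le> f"
    and Q: "\<And>xs' us' q' s' f'. \<lbrakk>tracks xs' us' q' s'; queue n xs' us'; length us = Suc (length us');
       f \<le> f' + (length us * (12 * n + 5) + 14)\<rbrakk> \<Longrightarrow> Q s' f'"
  shows "wp inp orc sign_next s f Q"
proof -
  obtain m where m: "length us = Suc m" using ne by (cases us) auto
  define z where "z = us ! m"
  \<comment> \<open>The witness that the search uses: a negative element if there is one, and \<open>z\<close> otherwise.\<close>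
  define q1 where "q1 = (if map_of xs q = Some Minus then q else z)"
  have sub: "fst ` set xs \<subseteq> {..<n}" and dist: "distinct us" and set_us: "set us = unsigned xs"
    and untriv: "\<forall>j\<in>set us. untrivial j"
    using queue by (auto simp: queue_def)
  have T: "legal_prefix V F (named xs)" "out s = map literal xs"
    "\<forall>j<n. arrays s signs (int j) = sign_code (map_of xs j)" "q < n"
    "map_of xs q = Some Minus \<or> (\<forall>j. map_of xs j \<noteq> Some Minus)"
    "\<forall>j<Suc m. arrays s todo (int j) = int (us ! j)"
    using tr m by (simp_all add: tracks_def)
  have "z \<in> set us" using m by (simp add: z_def)
  then have zn: "z < n" using set_us by auto
  have q1: "q1 < n" "q1 = z \<and> (\<forall>j. map_of xs j \<noteq> Some Minus) \<or> map_of xs q1 = Some Minus"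
    using T(4,5) zn by (auto simp: q1_def)
  have "wp inp orc prepare s f (\<lambda>s1 f1. wp inp orc (While (Equal (Reg sign_reg) (Const 0)) search_body) s1 f1
     (\<lambda>s2 f2. wp inp orc record_sign s2 f2 Q))"
  proof (rule prepare_spec[OF tr m z_def[symmetric], folded q1_def])
    show "7 \<le> f" using f by simp
    fix s1 :: state and f1
    assume s1: "arrays s1 = arrays s" "out s1 = out s" "regs s1 size_reg = int n" "regs s1 open_reg = int m"
       "regs s1 neg_reg = int q1" "regs s1 last_reg = int z" "regs s1 idx_reg = 0" "regs s1 sign_reg = 0" "f \<le> f1 + 7"
    show "wp inp orc (While (Equal (Reg sign_reg) (Const 0)) search_body) s1 f1 (\<lambda>s2 f2. wp inp orc record_sign s2 f2 Q)"
    proof (rule search_spec[OF queue m z_def[symmetric] _ _ s1(3,5,6,7,8) q1])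
      show "\<forall>j<n. arrays s1 signs (int j) = sign_code (map_of xs j)"
        "\<forall>j<Suc m. arrays s1 todo (int j) = int (us ! j)" using T s1(1) by simp_all
      show "Suc m * (12 * n + 5) + 1 \<le> f1" using f s1(9) m by simp
      fix s2 :: state and f2 i r
      assume s2: "arrays s2 = arrays s1" "out s2 = out s1" "\<forall>r\<in>{size_reg, open_reg, neg_reg, last_reg}. regs s2 r = regs s1 r"
        "i \<le> m" "regs s2 idx_reg = int i" "regs s2 cand_reg = int (us ! i)" "regs s2 sign_reg = sign_code (Some r)"
        "cfa_step V F (map_of (named xs)) (e (us ! i)) r" "f1 \<le> f2 + (Suc m * (12 * n + 5) + 1)"
      let ?v = "us ! i"
      let ?xs = "xs @ [(?v, r)]" and ?us = "butlast (us[i := z])" and ?q = "if r = Minus then ?v else q1"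
      have i: "i < length us" using s2(4) m by simp
      then have "?v \<in> set us" by simp
      then have v: "?v < n" using set_us by auto
      note snoc = legal_named_snoc[OF T(1) sub v s2(8)]
      have "us = butlast us @ [z]" using m ne unfolding z_def by (metis append_butlast_last_id last_conv_nth diff_Suc_1)
      note swap = swap_remove[OF this i dist]
      show "wp inp orc record_sign s2 f2 Q"
      proof (rule record_sign_spec[OF s2(5) _ s2(6,7)])
        show "regs s2 last_reg = int z" using s2(3) s1(6) by simp
        show "6 \<le> f2" using s2(9) s1(9) f m by simp
        fix s3 :: state and f3
        assume s3: "arrays s3 = (arrays s2)(todo := (arrays s2 todo)(int i := int z),
             signs := (arrays s2 signs)(int ?v := sign_code (Some r)))"
           "out s3 = out s2 @ [literal (?v, r)]" "regs s3 size_reg = regs s2 size_reg" "regs s3 open_reg = regs s2 open_reg"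
           "regs s3 neg_reg = (if r = Minus then int ?v else regs s2 neg_reg)" "f2 \<le> f3 + 6"
        show "Q s3 f3"
        proof (rule Q)
          show "tracks ?xs ?us ?q s3"
            unfolding tracks_def
          proof (intro conjI)
            show "legal_prefix V F (named ?xs)" by (rule snoc(1))
            show "out s3 = map literal ?xs" using s3(2) s2(2) s1(2) T(2) by simp
            show "regs s3 size_reg = int n" "regs s3 open_reg = int (length ?us)" "regs s3 neg_reg = int ?q"
              using s3(3,4,5) s2(3) s1(3,4,5) m by simp_all
            show "\<forall>j<n. arrays s3 signs (int j) = sign_code (map_of ?xs j)"
              unfolding snoc(3) using s3(1) s2(1) s1(1) T(3) by simp
            show "?q < n" using v q1(1) by simp
            show "map_of ?xs ?q = Some Minus \<or> (\<forall>j. map_of ?xs j \<noteq> Some Minus)"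
              unfolding snoc(3) using q1(2) snoc(2) by (cases r) auto
            show "\<forall>j<length ?us. arrays s3 todo (int j) = int (?us ! j)"
              using s3(1) s2(1) s1(1) T(6) m by (simp add: nth_butlast nth_list_update)
          qed
          show "queue n ?xs ?us"
            unfolding queue_def snoc(3) swap(2)
            using swap(1) sub v set_us untriv by auto
          show "length us = Suc (length ?us)" using m by simp
          show "f \<le> f3 + (length us * (12 * n + 5) + 14)" using s3(6) s2(9) s1(9) m by simp
        qed
      qed
    qed
  qed
  then show ?thesis by (simp add: sign_next_def wp_Seq)
qed

definition finished :: "state \<Rightarrow> bool" where
  "finished s \<longleftrightarrow> (\<exists>xs. cfa_run V F (named xs) \<and> set (map fst xs) = {..<n} \<and>
     distinct (map fst xs) \<and> out s = map literal xs)"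

lemma finishedI:
  assumes "cfa_run V F (named xs)" "fst ` set xs \<subseteq> {..<n}" "out s = map literal xs"
  shows "finished s"
proof -
  have legal_prefix: "legal_prefix V F (named xs)" and total: "\<forall>v\<in>V. map_of (named xs) v \<noteq> None"
    using assms(1) by (simp_all add: cfa_run_iff_legal)
  have "map_of xs i \<noteq> None" if "i < n" for i
    using bspec[OF total e_in[OF that]] map_of_named[OF assms(2) that] by simp
  then have "set (map fst xs) = {..<n}" using assms(2) by (force simp: map_of_eq_None_iff)
  moreover have "distinct (map fst (named xs))" by (rule legal_distinct[OF legal_prefix])
  then have "distinct (map e (map fst xs))" by (simp add: case_prod_unfold comp_def)
  then have "distinct (map fst xs)" using distinct_map by blast
  ultimately show ?thesis using assms unfolding finished_def by blast
qed

text \<open>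
  The credit bound is doubled to avoid the division in \<open>(12n + 5) * (m * (m + 1) / 2)\<close>, the cost of
  searching among \<open>m\<close>, \<open>m - 1\<close>, \<dots>, 1 candidates.
\<close>
lemma main_loop_spec:
  assumes "tracks xs us q s" "queue n xs us"
    and "(12 * n + 5) * (length us * (length us + 1)) + 30 * length us + 2 \<le> 2 * f"
  shows "wp inp orc (While (Less (Const 0) (Reg open_reg)) sign_next) s f (\<lambda>s' _. finished s')"
proof -
  define C where "C = 12 * n + 5"
  define I :: "state \<Rightarrow> nat \<Rightarrow> bool" where "I = (\<lambda>s f. \<exists>xs us q. tracks xs us q s \<and> queue n xs us \<and>
     C * (length us * (length us + 1)) + 30 * length us + 2 \<le> 2 * f)"
  show ?thesis
  proof (rule wp_While[where I = I])
    show "I s f" using assms unfolding I_def C_def by blast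
    fix s f assume "I s f"
    then obtain xs us q where I: "tracks xs us q s" "queue n xs us"
      "C * (length us * (length us + 1)) + 30 * length us + 2 \<le> 2 * f"
      unfolding I_def by blast
    have count: "regs s 1 = int (length us)" using I(1) by (simp add: tracks_def)
    show "1 \<le> f \<and> (if test_val s (Less (Const 0) (Reg open_reg)) then wp inp orc sign_next s (f - 1) I else finished s)"
    proof (cases "us = []")
      case True
      have "set us = unsigned xs" "fst ` set xs \<subseteq> {..<n}" using I(2) by (auto simp: queue_def)
      then have "\<forall>v\<in>V. map_of (named xs) v \<noteq> None" using True map_of_named unfolding ball_V by auto
      then have "cfa_run V F (named xs)" using I(1) by (simp add: cfa_run_iff_legal tracks_def)
      then have "finished s" using I(1) \<open>fst ` set xs \<subseteq> {..<n}\<close> by (intro finishedI) (simp_all add: tracks_def)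
      then show ?thesis using True count I(3) by simp
    next
      case False
      have "wp inp orc sign_next s (f - 1) I"
      proof (rule sign_next_spec[OF I(1,2) False])
        obtain m where m: "length us = Suc m" using False by (cases us) auto
        have double: "C * (length us * (length us + 1)) = C * (m * (m + 1)) + 2 * (length us * C)"
          unfolding m by (simp add: algebra_simps)
        show "length us * (12 * n + 5) + 14 \<le> f - 1"
          using I(3) m unfolding double C_def[symmetric] by simp
        fix xs' us' q' and s' :: state and f'
        assume *: "tracks xs' us' q' s'" "queue n xs' us'" "length us = Suc (length us')"
          "f - 1 \<le> f' + (length us * (12 * n + 5) + 14)"
        then have "length us' = m" using m by simp
        then have "C * (length us' * (length us' + 1)) + 30 * length us' + 2 \<le> 2 * f'"
          using I(3) *(4) m unfolding double C_def[symmetric] by simp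
        then show "I s' f'" unfolding I_def using *(1,2) by blast
      qed
      then show ?thesis using False count I(3) by simp
    qed
  qed
qed

lemma trivial_step:
  assumes tr: "tracks xs us q s" and queue: "queue i xs us" and i: "i < n"
    and triv: "trivially_forced V F (e i) r"
  shows "legal_prefix V F (named (xs @ [(i, r)]))" "map_of xs i = None"
    "map_of (xs @ [(i, r)]) = (map_of xs)(i \<mapsto> r)" "queue (Suc i) (xs @ [(i, r)]) us"
proof -
  have sub: "fst ` set xs \<subseteq> {..<i}" using queue by (simp add: queue_def)
  then have sub': "fst ` set xs \<subseteq> {..<n}" using i by auto
  have new: "map_of xs i = None" using sub by (force simp: map_of_eq_None_iff)
  have "cfa_step V F (map_of (named xs)) (e i) r"
    using triv i new by (intro cfa_step_trivial) (simp_all add: map_of_named[OF sub' i])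
  note snoc = legal_named_snoc[OF _ sub' i this]
  show "legal_prefix V F (named (xs @ [(i, r)]))" using snoc(1) tr by (simp add: tracks_def)
  show "map_of xs i = None" by (rule new)
  show upd: "map_of (xs @ [(i, r)]) = (map_of xs)(i \<mapsto> r)" by (rule map_of_snoc[OF new])
  show "queue (Suc i) (xs @ [(i, r)]) us"
    using queue i unfolding queue_def upd by (auto simp: less_Suc_eq)
qed

lemma dispatch_spec:
  assumes tr: "tracks xs us q s" and queue: "queue i xs us" and i: "i < n" "regs s idx_reg = int i"
    and x: "regs s tmp_reg = of_bool ({e i} \<in> F)" and y: "regs s aux_reg = of_bool (V - {e i} \<in> F)" and f: "6 \<le> f"
    and Q: "\<And>xs' us' q' s' f'. \<lbrakk>tracks xs' us' q' s'; queue (Suc i) xs' us'; regs s' idx_reg = int i;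
      arrays s' single = arrays s single; arrays s' rest = arrays s rest; f \<le> f' + 6\<rbrakk> \<Longrightarrow> Q s' f'"
  shows "wp inp orc dispatch s f Q"
proof -
  have T: "out s = map literal xs" "regs s size_reg = int n"
    "\<forall>j<n. arrays s signs (int j) = sign_code (map_of xs j)" "regs s neg_reg = int q" "q < n"
    "map_of xs q = Some Minus \<or> (\<forall>j. map_of xs j \<noteq> Some Minus)"
    "regs s open_reg = int (length us)" "\<forall>j<length us. arrays s todo (int j) = int (us ! j)"
    using tr by (simp_all add: tracks_def)
  consider (plus) "{e i} \<in> F" | (minus) "{e i} \<notin> F" "V - {e i} \<in> F" | (neither) "{e i} \<notin> F" "V - {e i} \<notin> F"
    by blast
  then show ?thesis
  proof cases
    case plus
    then have "trivially_forced V F (e i) Plus" by (simp add: trivially_forced_def)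
    note step = trivial_step[OF tr queue i(1) this]
    let ?s = "set_reg tmp_reg (int i + 1) (s\<lparr>arrays := (arrays s)(signs := (arrays s signs)(int i := 1))\<rparr>)
       \<lparr>out := out s @ [int i + 1]\<rparr>"
    have "tracks (xs @ [(i, Plus)]) us q ?s"
      unfolding tracks_def step(3) using step(1,2) T by auto
    then have "Q ?s (f - 4)" by (rule Q[OF _ step(4)]) (use i f in simp_all)
    then show ?thesis using plus x i f by (simp add: dispatch_def wp_simps eval_nat_numeral) arith
  next
    case minus
    then have "trivially_forced V F (e i) Minus" by (simp add: trivially_forced_def)
    note step = trivial_step[OF tr queue i(1) this]
    let ?s = "set_reg tmp_reg (- 1 - int i) (set_reg neg_reg (int i)
       (s\<lparr>arrays := (arrays s)(signs := (arrays s signs)(int i := - 1))\<rparr>))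
       \<lparr>out := out s @ [- 1 - int i]\<rparr>"
    have "tracks (xs @ [(i, Minus)]) us i ?s"
      unfolding tracks_def step(3) using step(1,2) T i by auto
    then have "Q ?s (f - 6)" by (rule Q[OF _ step(4)]) (use i f in simp_all)
    then show ?thesis using minus x y i f by (simp add: dispatch_def wp_simps eval_nat_numeral) arith
  next
    case neither
    have untriv: "untrivial i"
    proof
      fix r show "\<not> trivially_forced V F (e i) r" using neither by (cases r) (simp_all add: trivially_forced_def)
    qed
    let ?s = "set_reg open_reg (int (length us) + 1)
       (s\<lparr>arrays := (arrays s)(todo := (arrays s todo)(int (length us) := int i))\<rparr>)"
    have "tracks xs (us @ [i]) q ?s"
      using tr i unfolding tracks_def by (auto simp: nth_append less_Suc_eq)
    moreover have "map_of xs i = None" using queue by (force simp: queue_def map_of_eq_None_iff)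
    then have "queue (Suc i) xs (us @ [i])"
      using queue i untriv unfolding queue_def by (auto simp: less_Suc_eq)
    ultimately have "Q ?s (f - 4)" by (rule Q) (use i f in simp_all)
    then show ?thesis using neither x y i f T(7) by (simp add: dispatch_def wp_simps eval_nat_numeral) arith
  qed
qed

lemma test_trivial_spec:
  assumes tr: "tracks xs us q s" and queue: "queue i xs us" and i: "i < n" "regs s idx_reg = int i"
    and single: "\<forall>j. arrays s single (int j) = 0" and rest: "\<forall>j<n. arrays s rest (int j) = 1" and f: "13 \<le> f"
    and Q: "\<And>xs' us' q' s' f'. \<lbrakk>tracks xs' us' q' s'; queue (Suc i) xs' us'; regs s' idx_reg = int (Suc i);
      \<forall>j. arrays s' single (int j) = 0; \<forall>j<n. arrays s' rest (int j) = 1; f \<le> f' + 13\<rbrakk> \<Longrightarrow> Q s' f'"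
  shows "wp inp orc test_trivial s f Q"
proof -
  have "wp inp orc (ask tmp_reg single 1) s f (\<lambda>s f. wp inp orc (ask aux_reg rest 0) s f (\<lambda>s f. wp inp orc dispatch s f
      (\<lambda>s f. wp inp orc (Do (Add idx_reg (Reg idx_reg) (Const 1))) s f Q)))"
  proof (rule ask_spec[OF i(2)])
    show "arrays s single (int i) = 1 - 1" "tmp_reg \<noteq> idx_reg" "3 \<le> f" using single f by simp_all
    fix s1 :: state and f1
    assume s1: "arrays s1 = arrays s" "out s1 = out s"
      "regs s1 = (regs s)(tmp_reg := of_bool (orc {j. if j = i then (1::int) \<noteq> 0 else arrays s single (int j) \<noteq> 0}))"
      "f \<le> f1 + 3"
    have "{j. if j = i then (1::int) \<noteq> 0 else arrays s single (int j) \<noteq> 0} \<inter> {..<n} = {i}" using single i by auto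
    then have x: "regs s1 tmp_reg = of_bool ({e i} \<in> F)" using s1(3) by (simp add: crossing_oracle_def)
    have "regs s1 idx_reg = int i" using s1(3) i by simp
    then show "wp inp orc (ask aux_reg rest 0) s1 f1 (\<lambda>s f. wp inp orc dispatch s f
      (\<lambda>s f. wp inp orc (Do (Add idx_reg (Reg idx_reg) (Const 1))) s f Q))"
    proof (rule ask_spec)
      show "arrays s1 rest (int i) = 1 - 0" "aux_reg \<noteq> idx_reg" "3 \<le> f1" using rest f s1 i by simp_all
      fix s2 :: state and f2
      assume s2: "arrays s2 = arrays s1" "out s2 = out s1"
        "regs s2 = (regs s1)(aux_reg := of_bool (orc {j. if j = i then (0::int) \<noteq> 0 else arrays s1 rest (int j) \<noteq> 0}))"
        "f1 \<le> f2 + 3"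
      have "{j. if j = i then (0::int) \<noteq> 0 else arrays s1 rest (int j) \<noteq> 0} \<inter> {..<n} = {..<n} - {i}"
        using rest s1(1) by auto
      moreover have "e ` ({..<n} - {i}) = V - {e i}"
        using bij i by (auto simp: V_eq)
      ultimately have y: "regs s2 aux_reg = of_bool (V - {e i} \<in> F)"
        using s2(3) by (simp add: crossing_oracle_def)
      have tr2: "tracks xs us q s2"
        using tr unfolding tracks_def s2(1,2) s1(1,2) s2(3) s1(3) by simp
      have x2: "regs s2 tmp_reg = of_bool ({e i} \<in> F)" and ri2: "regs s2 idx_reg = int i"
        using s2(3) x s1(3) i by simp_all
      show "wp inp orc dispatch s2 f2 (\<lambda>s f. wp inp orc (Do (Add idx_reg (Reg idx_reg) (Const 1))) s f Q)"
      proof (rule dispatch_spec[OF tr2 queue i(1) ri2 x2 y])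
        show "6 \<le> f2" using f s1(4) s2(4) by simp
        fix xs' us' q' and s3 :: state and f3
        assume s3: "tracks xs' us' q' s3" "queue (Suc i) xs' us'" "regs s3 idx_reg = int i"
          "arrays s3 single = arrays s2 single" "arrays s3 rest = arrays s2 rest" "f2 \<le> f3 + 6"
        have "Q (set_reg idx_reg (int i + 1) s3) (f3 - 1)"
        proof (rule Q[OF _ s3(2)])
          show "tracks xs' us' q' (set_reg idx_reg (int i + 1) s3)" using s3(1) by (simp add: tracks_def)
        qed (use s3 s2 s1 single rest f in simp_all)
        then show "wp inp orc (Do (Add idx_reg (Reg idx_reg) (Const 1))) s3 f3 Q"
          using s3(3,6) s2(4) s1(4) f by (simp add: wp_simps)
      qed
    qed
  qed
  then show ?thesis by (simp add: test_trivial_def wp_Seq)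
qed

lemma trivial_loop_spec:
  assumes "tracks [] [] 0 s" "regs s idx_reg = 0"
    and "\<forall>j. arrays s single (int j) = 0" "\<forall>j<n. arrays s rest (int j) = 1"
    and f: "14 * n + 1 \<le> f"
    and Q: "\<And>xs us q s' f'. tracks xs us q s' \<Longrightarrow> queue n xs us \<Longrightarrow> f \<le> f' + (14 * n + 1) \<Longrightarrow> Q s' f'"
  shows "wp inp orc (While (Less (Reg idx_reg) (Reg size_reg)) test_trivial) s f Q"
proof -
  define I :: "state \<Rightarrow> nat \<Rightarrow> bool" where "I = (\<lambda>s' f'. \<exists>i xs us q. tracks xs us q s' \<and> queue i xs us \<and>
     regs s' idx_reg = int i \<and> (\<forall>j. arrays s' single (int j) = 0) \<and> (\<forall>j<n. arrays s' rest (int j) = 1) \<and>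
     f + 14 * (n - i) \<le> f' + 14 * n)"
  show ?thesis
  proof (rule wp_While[where I = I])
    have "queue 0 [] []" by (simp add: queue_def)
    then show "I s f" unfolding I_def using assms(1-4) by (intro exI[of _ 0] exI[of _ "[]"]) auto
    fix s' f' assume "I s' f'"
    then obtain i xs us q where I: "tracks xs us q s'" "queue i xs us" "regs s' idx_reg = int i"
      "\<forall>j. arrays s' single (int j) = 0" "\<forall>j<n. arrays s' rest (int j) = 1"
      "f + 14 * (n - i) \<le> f' + 14 * n"
      unfolding I_def by blast
    have i: "i \<le> n" using I(2) by (simp add: queue_def)
    have size: "regs s' size_reg = int n" using I(1) by (simp add: tracks_def)
    show "1 \<le> f' \<and> (if test_val s' (Less (Reg idx_reg) (Reg size_reg)) then wp inp orc test_trivial s' (f' - 1) I else Q s' (f' - 1))"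
    proof (cases "i < n")
      case True
      have "wp inp orc test_trivial s' (f' - 1) I"
      proof (rule test_trivial_spec[OF I(1,2) True I(3-5)])
        show "13 \<le> f' - 1" using I(6) f True by simp
        fix xs' us' q' and s'' :: state and f''
        assume *: "tracks xs' us' q' s''" "queue (Suc i) xs' us'" "regs s'' idx_reg = int (Suc i)"
          "\<forall>j. arrays s'' single (int j) = 0" "\<forall>j<n. arrays s'' rest (int j) = 1" "f' - 1 \<le> f'' + 13"
        have "f + 14 * (n - Suc i) \<le> f'' + 14 * n" using *(6) I(6) f True by simp
        then show "I s'' f''" unfolding I_def using *(1-5) by blast
      qed
      then show ?thesis using True I(3,6) size f by simp
    next
      case False
      then have "i = n" using i by simp
      then have "Q s' (f' - 1)" using I(6) f by (intro Q[OF I(1)]) (use I(2) in simp_all)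
      then show ?thesis using False I(3,6) size f \<open>i = n\<close> by simp
    qed
  qed
qed

lemma fill_loop_spec:
  assumes s: "regs s size_reg = int n" "regs s idx_reg = 0" and f: "3 * n + 1 \<le> f"
    and Q: "\<And>s' f'. \<lbrakk>out s' = out s; \<forall>x. x \<noteq> idx_reg \<longrightarrow> regs s' x = regs s x;
       \<forall>A. A \<noteq> rest \<longrightarrow> arrays s' A = arrays s A; \<forall>j<n. arrays s' rest (int j) = 1; f \<le> f' + (3 * n + 1)\<rbrakk> \<Longrightarrow> Q s' f'"
  shows "wp inp orc (While (Less (Reg idx_reg) (Reg size_reg)) (block [
         Do (Store rest (Reg idx_reg) (Const 1)), Do (Add idx_reg (Reg idx_reg) (Const 1))])) s f Q"
proof -
  define I :: "state \<Rightarrow> nat \<Rightarrow> bool" where "I = (\<lambda>s' f'. \<exists>i\<le>n. regs s' idx_reg = int i \<and> out s' = out s \<and>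
     (\<forall>x. x \<noteq> idx_reg \<longrightarrow> regs s' x = regs s x) \<and> (\<forall>A. A \<noteq> rest \<longrightarrow> arrays s' A = arrays s A) \<and>
     (\<forall>j<i. arrays s' rest (int j) = 1) \<and> f + 3 * (n - i) \<le> f' + 3 * n)"
  show ?thesis
  proof (rule wp_While[where I = I])
    show "I s f" using s by (simp add: I_def)
    fix s' f' assume "I s' f'"
    then obtain i where I: "i \<le> n" "regs s' idx_reg = int i" "out s' = out s"
     "\<forall>x. x \<noteq> idx_reg \<longrightarrow> regs s' x = regs s x" "\<forall>A. A \<noteq> rest \<longrightarrow> arrays s' A = arrays s A"
     "\<forall>j<i. arrays s' rest (int j) = 1" "f + 3 * (n - i) \<le> f' + 3 * n"
      unfolding I_def by blast
    have size: "regs s' size_reg = int n" using I(4) s(1) by simp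
    let ?body = "block [Do (Store rest (Reg idx_reg) (Const 1)), Do (Add idx_reg (Reg idx_reg) (Const 1))]"
    show "1 \<le> f' \<and> (if test_val s' (Less (Reg idx_reg) (Reg size_reg)) then wp inp orc ?body s' (f' - 1) I else Q s' (f' - 1))"
    proof (cases "i < n")
      case True
      let ?s = "set_reg idx_reg (int i + 1) (s'\<lparr>arrays := (arrays s')(rest := (arrays s' rest)(int i := 1))\<rparr>)"
      have "I ?s (f' - 1 - 1 - 1)"
        unfolding I_def using I f True by (intro exI[of _ "Suc i"]) (simp add: less_Suc_eq)
      then have "wp inp orc ?body s' (f' - 1) I" using I f True by (simp add: wp_simps) arith
      then show ?thesis using True I size f by simp
    next
      case False
      then have "i = n" using I(1) by simp
      then have "Q s' (f' - 1)" using I f by (intro Q) simp_all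
      then show ?thesis using False I size f \<open>i = n\<close> by simp
    qed
  qed
qed

lemma sign_few_spec:
  assumes s: "regs s size_reg = int n" "out s = []" and n: "n < 3" and f: "n < 2 \<Longrightarrow> 3 \<le> f" "n = 2 \<Longrightarrow> 5 \<le> f"
  shows "wp inp orc sign_few s f (\<lambda>s' _. finished s')"
proof -
  have sub: "F \<subseteq> Pow V - {{}, V}" using hyp by (simp add: cosigning_hypotheses_def)
  consider "n = 0" | "n = 1" | "n = 2" using n by linarith
  then show ?thesis
  proof cases
    case 1
    then have "cfa_run V F (named [])" using V_eq by simp
    then have "finished s" using s by (intro finishedI) simp_all
    then show ?thesis using 1 s f by (simp add: sign_few_def wp_simps) arith
  next
    case 2
    then have V: "V = {e 0}" using V_eq by (simp add: lessThan_Suc)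
    then have "F = {}" using sub by (auto simp: Pow_insert)
    then have run: "cfa_run V F (named [(0, Plus)])" using V by (simp add: cfa_step_empty_family)
    have "finished (s\<lparr>out := [1]\<rparr>)" by (rule finishedI[OF run]) (use 2 in simp_all)
    then show ?thesis using 2 s f by (simp add: sign_few_def wp_simps) arith
  next
    case 3
    then have V: "V = {e 0, e 1}" "e 0 \<noteq> e 1" using V_eq by (auto simp: lessThan_Suc numeral_2_eq_2)
    have "describes V (d (e 0) (e 1)) (separating_subfamily F (e 0) (e 1))"
      using provided V by (simp add: well_provided_def)
    then have "d (e 0) (e 1) \<noteq> None \<longleftrightarrow> separating_subfamily F (e 0) (e 1) \<noteq> {}"
      by (cases "d (e 0) (e 1)") (simp, use describes_bounds(1) in fastforce)
    also have "\<dots> \<longleftrightarrow> {e 0} \<in> F"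
    proof -
      have "F \<subseteq> {{e 0}, {e 1}}" using sub V by (auto simp: Pow_insert)
      then show ?thesis using V(2) by (auto simp: separating_subfamily_def)
    qed
    finally have iff: "inp Nonempty [0, 1] = of_bool ({e 0} \<in> F)" by simp
    note runs = cfa_run_two_elements[OF hyp V]
    show ?thesis
    proof (cases "{e 0} \<in> F")
      case True
      let ?s = "set_reg tmp_reg 1 s\<lparr>out := [1, - 2]\<rparr>"
      have "finished ?s"
        by (rule finishedI[of "[(0, Plus), (1, Minus)]"]) (use runs(1)[OF True] 3 in simp_all)
      then show ?thesis using 3 s f iff True by (simp add: sign_few_def wp_simps set_reg_def) arith
    next
      case False
      let ?s = "set_reg tmp_reg 0 s\<lparr>out := [- 1, 2]\<rparr>"
      have "finished ?s"
        by (rule finishedI[of "[(0, Minus), (1, Plus)]"]) (use runs(2)[OF False] 3 in simp_all)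
      then show ?thesis using 3 s f iff False by (simp add: sign_few_def wp_simps set_reg_def) arith
    qed
  qed
qed

text \<open>
  The additional 5 units pay for the tests on the empty ground set, where the main bound is 0.
\<close>
lemma forcing_program_spec:
  assumes f: "2 * n ^ 3 * (2 * n + 1) + (if n = 0 then 5 else 0) \<le> f"
  shows "wp inp orc forcing_program initial f (\<lambda>s _. finished s)"
proof -
  define s1 where "s1 = set_reg size_reg (int n) initial"
  have s1: "regs s1 size_reg = int n" "\<forall>x. x \<noteq> size_reg \<longrightarrow> regs s1 x = 0" "arrays s1 = (\<lambda>_ _. 0)" "out s1 = []"
    by (simp_all add: s1_def initial_def)
  show ?thesis
  proof (cases "n < 3")
    case True
    then have "n = 0 \<or> n = 1 \<or> n = 2" by linarith
    then have "5 \<le> f" "n = 2 \<Longrightarrow> 7 \<le> f" using f by auto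
    moreover from this have "wp inp orc sign_few s1 (f - 1 - 1) (\<lambda>s _. finished s)"
      by (intro sign_few_spec[OF s1(1,4) True]) auto
    ultimately show ?thesis using True by (simp add: forcing_program_def wp_simps s1_def)
  next
    case False
    have cost: "(12 * n + 5) * (n * (n + 1)) + 64 * n + 12 \<le> 2 * f"
      using cost_bound[of n] False f by simp
    have "wp inp orc (While (Less (Reg idx_reg) (Reg size_reg)) (block [
         Do (Store rest (Reg idx_reg) (Const 1)), Do (Add idx_reg (Reg idx_reg) (Const 1))])) s1 (f - 1 - 1)
       (\<lambda>s f. 1 \<le> f \<and> wp inp orc (While (Less (Reg idx_reg) (Reg size_reg)) test_trivial) (set_reg idx_reg 0 s) (f - 1)
         (\<lambda>s f. wp inp orc (While (Less (Const 0) (Reg open_reg)) sign_next) s f (\<lambda>s _. finished s)))"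
    proof (rule fill_loop_spec[OF s1(1)])
      show "regs s1 idx_reg = 0" using s1(2) by simp
      show "3 * n + 1 \<le> f - 1 - 1" using cost by linarith
      fix s2 :: state and f2
      assume s2: "out s2 = out s1" "\<forall>x. x \<noteq> idx_reg \<longrightarrow> regs s2 x = regs s1 x"
       "\<forall>A. A \<noteq> rest \<longrightarrow> arrays s2 A = arrays s1 A" "\<forall>j<n. arrays s2 rest (int j) = 1"
       "f - 1 - 1 \<le> f2 + (3 * n + 1)"
      have cost2: "(12 * n + 5) * (n * (n + 1)) + 58 * n + 6 \<le> 2 * f2" using cost s2(5) by linarith
      have "wp inp orc (While (Less (Reg idx_reg) (Reg size_reg)) test_trivial) (set_reg idx_reg 0 s2) (f2 - 1)
         (\<lambda>s f. wp inp orc (While (Less (Const 0) (Reg open_reg)) sign_next) s f (\<lambda>s _. finished s))"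
      proof (rule trivial_loop_spec)
        show "tracks [] [] 0 (set_reg idx_reg 0 s2)"
          using s1 s2(1-3) False by (simp add: tracks_def legal_prefix_Nil)
        show "\<forall>j. arrays (set_reg idx_reg 0 s2) single (int j) = 0" using s1 s2(3) by simp
        show "14 * n + 1 \<le> f2 - 1" using cost2 by linarith
        fix xs us q and s3 :: state and f3
        assume s3: "tracks xs us q s3" "queue n xs us" "f2 - 1 \<le> f3 + (14 * n + 1)"
        have "card (set us) = length us" "set us \<subseteq> {..<n}"
          using s3(2) distinct_card[of us] by (auto simp: queue_def)
        then have len: "length us \<le> n" using card_mono[of "{..<n}" "set us"] by simp
        have "(12 * n + 5) * (length us * (length us + 1)) \<le> (12 * n + 5) * (n * (n + 1))"
          using len by (intro mult_le_mono) auto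
        then show "wp inp orc (While (Less (Const 0) (Reg open_reg)) sign_next) s3 f3 (\<lambda>s _. finished s)"
          using len cost2 s3(3) by (intro main_loop_spec[OF s3(1,2)]) linarith
      qed (use s2(4) in simp_all)
      then show "1 \<le> f2 \<and> wp inp orc (While (Less (Reg idx_reg) (Reg size_reg)) test_trivial) (set_reg idx_reg 0 s2) (f2 - 1)
         (\<lambda>s f. wp inp orc (While (Less (Const 0) (Reg open_reg)) sign_next) s f (\<lambda>s _. finished s))"
        using cost2 by simp
    qed
    then show ?thesis using False cost by (simp add: forcing_program_def wp_simps s1_def)
  qed
qed

end

section \<open>The theorem\<close>

theorem mainTheorem6:
  shows "(\<forall>(V :: 'a set) F xs. cosigning_hypotheses V F \<and> cfa_run V F xs
            \<longrightarrow> cosigning V F (signing_of xs))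
    \<and> (\<exists>P. \<forall>(V :: 'a set) F d e n.
          cosigning_hypotheses V F \<and> well_provided V F d \<and> enumerates e V \<and> n = card V \<and> n \<ge> 1
          \<longrightarrow> (\<exists>xs t. cfa_run V F (map (\<lambda>(i, s). (e i, s)) xs)
                 \<and> set (map fst xs) = {..<n}
                 \<and> computes_in P (crossing_input n e d) (crossing_oracle n e F) t (map literal xs)
                 \<and> (\<forall>T. minimiser_time n T \<longrightarrow> t \<le> 2 * n ^ 3 * T)))
    \<and> (\<exists>Q (p :: nat poly). \<forall>(V :: 'a set) F d e n.
          cosigning_hypotheses V F \<and> well_provided V F d \<and> enumerates e V \<and> n = card V
          \<longrightarrow> (\<exists>xs t. distinct (map fst xs) \<and> set (map fst xs) = {..<n}
                 \<and> cosigning V F (signing_of (map (\<lambda>(i, s). (e i, s)) xs))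
                 \<and> computes_in Q (crossing_input n e d) (crossing_oracle n e F) t (map literal xs)
                 \<and> t \<le> poly p n))"
proof (intro conjI)
  have run: "\<exists>xs t. cfa_run V F (map (\<lambda>(i, s). (e i, s)) xs) \<and> set (map fst xs) = {..<n} \<and>
      distinct (map fst xs) \<and>
      computes_in forcing_program (crossing_input n e d) (crossing_oracle n e F) t (map literal xs) \<and>
      t \<le> 2 * n ^ 3 * (2 * n + 1) + (if n = 0 then 5 else 0)"
    if "cosigning_hypotheses V F" "well_provided V F d" "enumerates e V" "n = card V"
    for V :: "'a set" and F d e n
  proof -
    interpret cosigning_instance V F d e n using that by unfold_locales
    obtain t s where "exec (crossing_input n e d) (crossing_oracle n e F) forcing_program initial t s"
      "t \<le> 2 * n ^ 3 * (2 * n + 1) + (if n = 0 then 5 else 0)" "finished s"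
      using forcing_program_spec[OF order_refl] unfolding wp_def by blast
    then show ?thesis unfolding finished_def computes_in_def by blast
  qed
  show "\<forall>(V :: 'a set) F xs. cosigning_hypotheses V F \<and> cfa_run V F xs \<longrightarrow> cosigning V F (signing_of xs)"
    using cfa_run_cosigning by blast
  show "\<exists>P. \<forall>(V :: 'a set) F d e n.
          cosigning_hypotheses V F \<and> well_provided V F d \<and> enumerates e V \<and> n = card V \<and> n \<ge> 1
          \<longrightarrow> (\<exists>xs t. cfa_run V F (map (\<lambda>(i, s). (e i, s)) xs)
                 \<and> set (map fst xs) = {..<n}
                 \<and> computes_in P (crossing_input n e d) (crossing_oracle n e F) t (map literal xs)
                 \<and> (\<forall>T. minimiser_time n T \<longrightarrow> t \<le> 2 * n ^ 3 * T))"
  proof (intro exI[of _ forcing_program] allI impI, elim conjE)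
    fix V :: "'a set" and F d e n
    assume "cosigning_hypotheses V F" "well_provided V F d" "enumerates e V" "n = card V" and pos: "n \<ge> 1"
    from run[OF this(1-4)] obtain xs t where *: "cfa_run V F (map (\<lambda>(i, s). (e i, s)) xs)"
      "set (map fst xs) = {..<n}"
      "computes_in forcing_program (crossing_input n e d) (crossing_oracle n e F) t (map literal xs)"
      "t \<le> 2 * n ^ 3 * (2 * n + 1) + (if n = 0 then 5 else 0)"
      by blast
    have "t \<le> 2 * n ^ 3 * T" if "minimiser_time n T" for T
    proof -
      have "2 * n + 1 \<le> T" using that minimiser_time_lower_bound unfolding minimiser_time_def by blast
      then have "2 * n ^ 3 * (2 * n + 1) \<le> 2 * n ^ 3 * T" by (rule mult_le_mono2)
      then show ?thesis using *(4) pos by simp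
    qed
    then show "\<exists>xs t. cfa_run V F (map (\<lambda>(i, s). (e i, s)) xs)
                 \<and> set (map fst xs) = {..<n}
                 \<and> computes_in forcing_program (crossing_input n e d) (crossing_oracle n e F) t (map literal xs)
                 \<and> (\<forall>T. minimiser_time n T \<longrightarrow> t \<le> 2 * n ^ 3 * T)"
      using * by blast
  qed
  show "\<exists>Q (p :: nat poly). \<forall>(V :: 'a set) F d e n.
          cosigning_hypotheses V F \<and> well_provided V F d \<and> enumerates e V \<and> n = card V
          \<longrightarrow> (\<exists>xs t. distinct (map fst xs) \<and> set (map fst xs) = {..<n}
                 \<and> cosigning V F (signing_of (map (\<lambda>(i, s). (e i, s)) xs))
                 \<and> computes_in Q (crossing_input n e d) (crossing_oracle n e F) t (map literal xs)
                 \<and> t \<le> poly p n)"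
  \<comment> \<open>The polynomial is \<open>2n\<^sup>3(2n + 1) + 5\<close>.\<close>
  proof (intro exI[of _ forcing_program] exI[of _ "[:5, 0, 0, 2, 4:] :: nat poly"] allI impI, elim conjE)
    fix V :: "'a set" and F d e n
    assume hyps: "cosigning_hypotheses V F" "well_provided V F d" "enumerates e V" "n = card V"
    from run[OF this] obtain xs t where *: "cfa_run V F (map (\<lambda>(i, s). (e i, s)) xs)"
      "set (map fst xs) = {..<n}" "distinct (map fst xs)"
      "computes_in forcing_program (crossing_input n e d) (crossing_oracle n e F) t (map literal xs)"
      "t \<le> 2 * n ^ 3 * (2 * n + 1) + (if n = 0 then 5 else 0)"
      by blast
    have "2 * n ^ 3 * (2 * n + 1) + (if n = 0 then 5 else 0) \<le> poly [:5, 0, 0, 2, 4:] n"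
      by (simp add: algebra_simps power3_eq_cube)
    then have "t \<le> poly [:5, 0, 0, 2, 4:] n" using *(5) by (rule order_trans[rotated])
    then show "\<exists>xs t. distinct (map fst xs) \<and> set (map fst xs) = {..<n}
                 \<and> cosigning V F (signing_of (map (\<lambda>(i, s). (e i, s)) xs))
                 \<and> computes_in forcing_program (crossing_input n e d) (crossing_oracle n e F) t (map literal xs)
                 \<and> t \<le> poly [:5, 0, 0, 2, 4:] n"
      using * cfa_run_cosigning[OF hyps(1) *(1)] by blast
  qed
qed

end
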